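(* Let $(X;R)$ be any finite group presentation, let $G=\langle X\mid R\rangle$, let $L(R)=\sum_{r\in R}|r|$, let $H\subset F(X)$ be a finite set, let $q\in(0,1)$, and let $\mathcal P(\mathcal I)$ and $\mathcal P(H^\pm)$ be any fixed probability distributions on the set $\mathcal I$ of elementary identities and on $H^{\pm}=H\cup H^{-1}$. For $n\ge0$ let $\rho'_{n,q,H}$ be the distribution of the output of the procedure RandomSubgroupWord2 on input $((X;R),H,n,q)$. Then the algorithm $\mathcal A_{MP}$ solves the randomized membership search problem $(\mathrm{MSP}(H),\{\rho'_{n,q,H}\}_{n\ge0})$ generically in polynomial time $\tilde O\big(n^{1+e^2\ln L(R)}\big)$; that is, there is a function $T(n)\in\tilde O\big(n^{1+e^2\ln L(R)}\big)$ such that $$\rho'_{n,q,H}\{\,w'\in \mathrm{MSP}(H) : T_{\mathcal A_{MP}}(w')\le T(n)\,\}\to 1\quad\text{as } n\to\infty,$$ where $T_{\mathcal A_{MP}}(w')$ is the time spent by $\mathcal A_{MP}$ on $w'$ and the elements of $H$.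
   Context: Notation. $X$ is a finite set, $X^{\pm}=X\cup X^{-1}$, $(X^\pm)^*$ is the free monoid of words, $F(X)$ is the free group (identified with reduced words), $\varepsilon$ is the empty word, $|w|$ is word length, $\circ$ is concatenation, $\overline w$ is the free reduction of $w$. A finite presentation is a pair $(X;R)$ with $X$ and $R\subseteq F(X)$ finite. A set of words is symmetrized if it consists of cyclically reduced words and is closed under inverses and cyclic permutations; $R^\star$ is the minimal symmetrized set containing $R$ (all words being cyclically reduced); $(X;R)$ is symmetrized if $R=R^\star$. A finite presentation can be efficiently symmetrized, and symmetrization does not change the computational properties of the fundamental (word, conjugacy, membership) problems. $L(H)=\sum_{h\in H}|h|$. Computations are on a random access machine. $\tilde O(n^c)$ denotes the class $\bigcup_{k\ge0}O(n^c\ln^k(n))$; likewise, for other bounds $\tilde O$ suppresses polylogarithmic factors. Generator. $\mathcal I=\{xx^{-1},x^{-1}x : x\in X\}\cup R\subset (X^\pm)^*$. A random $\mathcal I$-transformation of a word $v$ inserts a word $u$ sampled from $\mathcal P(\mathcal I)$ into $v$ (without cancellation) at a position $p$ chosen uniformly from $\{0,\dots,|v|\}$, all choices independent. RandomSubgroupWord2$((X;R),H,n,q)$: set $w_0=\varepsilon$; for $i=1,\dots,n$, with probability $q$ set $w_i=w_{i-1}\circ u$ with $u$ sampled from $\mathcal P(H^\pm)$, and otherwise obtain $w_i$ from $w_{i-1}$ by a random $\mathcal I$-transformation; return $w'=\overline{w_n}$. (If $H=\emptyset$, the procedure is regarded as equivalent to the one in which all $n$ steps are random $\mathcal I$-transformations.)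 $\mathrm{MSP}(H)=\{w'\in F(X): w'\in\langle H\rangle\text{ in }G\}$. Depth. A generalized van Kampen diagram over $\langle H\rangle\le\langle X\mid R\rangle$ is a finite connected planar digraph $D$ with edges labelled by $X$ (read as inverse letters when traversed backwards), with a base vertex $v_0$ on the boundary of the unbounded component $c_{out}$ of $\mathbb R^2\setminus D$, all bounded components (cells, set $C(D)$) being connected and simply connected, such that each cell $c$ either has boundary label in $R^\star$, or has $v_0\in\partial c$ and boundary label read from $v_0$ in $H^\pm$. Its label $\mu(D)$ is read along the boundary of $c_{out}$ counterclockwise from $v_0$. The dual graph has vertex set $C(D)\cup\{c_{out}\}$, with $c_1,c_2$ adjacent iff $\partial c_1\cap\partial c_2\neq\emptyset$; $d^*$ is its graph distance; $\delta(D)=\max_{c\in C(D)}d^*(c,c_{out})$ ($0$ if there are no cells). $\delta_H(w)=\min\{\delta(D):\mu(D)=w\}$ over generalized van Kampen diagrams if $w\in\langle H\rangle$ in $G$, and $\infty$ otherwise. Solver $\mathcal A_{MP}$. It is described for a symmetrized presentation $(X;R)$ and words $w$, $h_1,\dots,h_m$ (the elements of $H$): let $\Gamma_0$ be the $X$-digraph consisting of loops labelled $h_1,\dots,h_m$ at a vertex $v_0$ and a path labelled $w$ from $v_0$ to a vertex $v_{end}$. While $v_0\ne v_{end}$ in the current graph $\Gamma_{i-1}$, set $\Gamma_i=S(\mathcal C(\Gamma_{i-1}))$, where $\mathcal C(\Gamma)$ is obtained from $\Gamma$ by adding at every vertex of $\Gamma$ a loop labelled $r$ for every $r\in R$, and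 $S$ is Stallings folding (performed in nearly linear time). Return YES and the final graph. For a finite symmetrized presentation its running time is bounded by $\tilde O\big((|w|+L(H))L(R)^{\delta_H(w)}\big)$. *)

theory Defs
  imports
    "HOL-Probability.Probability"
    "HOL-Library.Landau_Symbols"
    "HOL-Algebra.Generated_Groups"
begin

section \<open>Words and free groups\<close>

text \<open>The letter \<open>(x, True)\<close> stands for \<open>x\<close>, the letter \<open>(x, False)\<close> for its formal inverse.\<close>

type_synonym 'a letter = "'a \<times> bool"
type_synonym 'a gword = "'a letter list"

definition linv :: "'a letter \<Rightarrow> 'a letter" where
  "linv a = (fst a, \<not> snd a)"

definition winv :: "'a gword \<Rightarrow> 'a gword" where
  "winv w = rev (map linv w)"

definition word_reduced :: "'a gword \<Rightarrow> bool" where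
  "word_reduced w \<longleftrightarrow> successively (\<lambda>a b. b \<noteq> linv a) w"

definition cyc_reduced :: "'a gword \<Rightarrow> bool" where
  "cyc_reduced w \<longleftrightarrow> word_reduced w \<and> (w \<noteq> [] \<longrightarrow> hd w \<noteq> linv (last w))"

fun cancel_cons :: "'a letter \<Rightarrow> 'a gword \<Rightarrow> 'a gword" where
  "cancel_cons a [] = [a]"
| "cancel_cons a (b # w) = (if b = linv a then w else a # b # w)"

definition freduce :: "'a gword \<Rightarrow> 'a gword" where
  "freduce w = foldr cancel_cons w []"

definition free_group :: "'a set \<Rightarrow> 'a gword monoid" where
  "free_group X = \<lparr>carrier = {w. set w \<subseteq> X \<times> UNIV \<and> word_reduced w},
                   monoid.mult = (\<lambda>u v. freduce (u @ v)), one = []\<rparr>"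

lemma linv_linv [simp]: "linv (linv a) = a"
  by (cases a) (simp add: linv_def)

lemma linv_eq_iff: "b = linv a \<longleftrightarrow> a = linv b"
  by (metis linv_linv)

lemma winv_winv [simp]: "winv (winv w) = w"
  by (simp add: winv_def rev_map comp_def)

lemma reduced_Cons: "word_reduced (a # w) \<longleftrightarrow> word_reduced w \<and> (w \<noteq> [] \<longrightarrow> hd w \<noteq> linv a)"
  by (cases w) (auto simp: word_reduced_def)

lemma reduced_cancel_cons: "word_reduced w \<Longrightarrow> word_reduced (cancel_cons a w)"
  by (cases w) (auto simp: word_reduced_def successively_Cons)

lemma cancel_cons_linv: "word_reduced w \<Longrightarrow> cancel_cons a (cancel_cons (linv a) w) = w"
  by (cases w; cases "tl w") (auto simp: word_reduced_def linv_eq_iff)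

lemma freduce_append: "freduce (u @ v) = foldr cancel_cons u (freduce v)"
  by (simp add: freduce_def)

lemma reduced_foldr: "word_reduced v \<Longrightarrow> word_reduced (foldr cancel_cons u v)"
  by (induction u) (auto intro: reduced_cancel_cons)

lemma reduced_freduce [simp]: "word_reduced (freduce w)"
  unfolding freduce_def by (rule reduced_foldr) (simp add: word_reduced_def)

lemma freduce_reduced: "word_reduced w \<Longrightarrow> freduce w = w"
proof (induction w)
  case (Cons a w)
  then have "freduce (a # w) = cancel_cons a w"
    by (simp add: freduce_def reduced_Cons)
  with Cons.prems show ?case by (cases w) (auto simp: reduced_Cons)
qed (simp add: freduce_def)

lemma freduce_append_right: "freduce (u @ freduce v) = freduce (u @ v)"
  by (simp add: freduce_append freduce_reduced)

lemma foldr_cancel_cons_step: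
  "word_reduced v \<Longrightarrow> foldr cancel_cons (cancel_cons a u) v = cancel_cons a (foldr cancel_cons u v)"
  by (cases u) (auto simp: cancel_cons_linv reduced_foldr)

lemma freduce_append_left: "freduce (freduce u @ v) = freduce (u @ v)"
proof (induction u)
  case (Cons a u)
  have "freduce (freduce (a # u) @ v) = foldr cancel_cons (cancel_cons a (freduce u)) (freduce v)"
    by (simp add: freduce_append) (simp add: freduce_def)
  also have "\<dots> = cancel_cons a (freduce (freduce u @ v))"
    by (simp add: foldr_cancel_cons_step freduce_append)
  also have "\<dots> = freduce ((a # u) @ v)"
    by (simp add: Cons.IH) (simp add: freduce_def)
  finally show ?case .
qed (simp add: freduce_def)

lemma set_cancel_cons: "set (cancel_cons a w) \<subseteq> insert a (set w)"
  by (cases w) auto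

lemma set_freduce: "set (freduce w) \<subseteq> set w"
proof (induction w)
  case (Cons a w)
  then show ?case
    using set_cancel_cons[of a "freduce w"] by (auto simp: freduce_def)
qed (simp add: freduce_def)

lemma set_winv: "set (winv w) = linv ` set w"
  by (simp add: winv_def)

lemma reduced_winv:
  assumes "word_reduced w" shows "word_reduced (winv w)"
proof -
  have "successively (\<lambda>x y. x \<noteq> linv y) w"
    using assms unfolding word_reduced_def
    by (rule successively_mono) (auto simp: linv_eq_iff)
  then show ?thesis
    unfolding word_reduced_def winv_def successively_rev successively_map
    by (rule successively_mono) (metis linv_linv)
qed

lemma freduce_winv_append: "freduce (winv w @ w) = []"
proof (induction w)
  case (Cons a w)
  have "winv (a # w) @ a # w = winv w @ ([linv a, a] @ w)"
    by (simp add: winv_def)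
  moreover have "freduce ([linv a, a] @ w) = freduce w"
    using cancel_cons_linv[OF reduced_freduce, of "linv a" w] by (simp add: freduce_def)
  ultimately show ?case
    using Cons.IH by (metis freduce_append_right)
qed (simp add: winv_def freduce_def)

lemma group_free_group: "group (free_group X)"
proof (rule groupI, goal_cases)
  case (1 u v)
  then show ?case
    using set_freduce[of "u @ v"] by (auto simp: free_group_def)
next
  case 2
  show ?case by (simp add: free_group_def word_reduced_def)
next
  case (3 u v w)
  then show ?case by (simp add: free_group_def freduce_append_left freduce_append_right)
next
  case (4 w)
  then show ?case by (simp add: free_group_def freduce_reduced)
next
  case (5 w)
  then show ?case
    by (intro bexI[of _ "winv w"])
       (auto simp: free_group_def freduce_winv_append reduced_winv set_winv linv_def)
qed

section \<open>Presentations, symmetrization and the membership search problem\<close>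

definition normal_closure :: "'a set \<Rightarrow> 'a gword set \<Rightarrow> 'a gword set" where
  "normal_closure X R = generate (free_group X)
     {g \<otimes>\<^bsub>free_group X\<^esub> r \<otimes>\<^bsub>free_group X\<^esub> inv\<^bsub>free_group X\<^esub> g | g r.
        g \<in> carrier (free_group X) \<and> r \<in> R}"

lemma normal_normal_closure:
  assumes "R \<subseteq> carrier (free_group X)"
  shows "normal_closure X R \<lhd> free_group X"
proof -
  interpret F: group "free_group X" by (rule group_free_group)
  show ?thesis
    unfolding normal_closure_def
  proof (rule F.normal_generateI, goal_cases)
    case 1
    then show ?case using assms by auto
  next
    case (2 h g)
    then obtain k r where kr: "k \<in> carrier (free_group X)" "r \<in> R"
      "h = k \<otimes>\<^bsub>free_group X\<^esub> r \<otimes>\<^bsub>free_group X\<^esub> inv\<^bsub>free_group X\<^esub> k" by auto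
    with assms have "r \<in> carrier (free_group X)" by auto
    with 2 kr have "g \<otimes>\<^bsub>free_group X\<^esub> h \<otimes>\<^bsub>free_group X\<^esub> inv\<^bsub>free_group X\<^esub> g =
      (g \<otimes>\<^bsub>free_group X\<^esub> k) \<otimes>\<^bsub>free_group X\<^esub> r \<otimes>\<^bsub>free_group X\<^esub>
        inv\<^bsub>free_group X\<^esub> (g \<otimes>\<^bsub>free_group X\<^esub> k)"
      by (simp add: F.m_assoc F.inv_mult_group)
    with 2 kr show ?case by blast
  qed
qed

definition presented_group :: "'a set \<Rightarrow> 'a gword set \<Rightarrow> 'a gword set monoid" where
  "presented_group X R = free_group X Mod normal_closure X R"

definition pres_class :: "'a set \<Rightarrow> 'a gword set \<Rightarrow> 'a gword \<Rightarrow> 'a gword set" where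
  "pres_class X R w = normal_closure X R #>\<^bsub>free_group X\<^esub> w"

definition MSP :: "'a set \<Rightarrow> 'a gword set \<Rightarrow> 'a gword set \<Rightarrow> 'a gword set" where
  "MSP X R H = {w \<in> carrier (free_group X).
     pres_class X R w \<in> generate (presented_group X R) (pres_class X R ` H)}"

definition total_length :: "'a gword set \<Rightarrow> nat" where
  "total_length R = (\<Sum>r\<in>R. length r)"

definition symmetrized :: "'a gword set \<Rightarrow> bool" where
  "symmetrized S \<longleftrightarrow> (\<forall>w\<in>S. cyc_reduced w \<and> winv w \<in> S \<and> (\<forall>k. rotate k w \<in> S))"

text \<open>
  If the words of \<open>R\<close> are cyclically reduced, then this is the least symmetrized set
  containing \<open>R\<close> (lemma \<open>star_least_symmetrized\<close>); otherwise no symmetrized set contains \<open>R\<close>,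
  and \<open>star R\<close> is the closure of \<open>R\<close> under inverses and cyclic permutations.
\<close>

inductive_set star :: "'a gword set \<Rightarrow> 'a gword set" for R where
  base: "r \<in> R \<Longrightarrow> r \<in> star R"
| winv: "r \<in> star R \<Longrightarrow> winv r \<in> star R"
| rotate: "r \<in> star R \<Longrightarrow> rotate k r \<in> star R"

lemma cyc_reduced_winv: "cyc_reduced w \<Longrightarrow> cyc_reduced (winv w)"
  using reduced_winv[of w]
  by (auto simp: cyc_reduced_def winv_def hd_rev last_rev hd_map last_map)

lemma cyc_reduced_rotate1: "cyc_reduced w \<Longrightarrow> cyc_reduced (rotate1 w)"
proof (cases w)
  case (Cons a v)
  assume "cyc_reduced w"
  with Cons show ?thesis
    by (cases "v = []")
       (auto simp: cyc_reduced_def word_reduced_def successively_append_iff successively_Cons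
             dest: linv_eq_iff[THEN iffD1])
qed simp

lemma cyc_reduced_rotate: "cyc_reduced w \<Longrightarrow> cyc_reduced (rotate k w)"
  by (induction k) (auto intro: cyc_reduced_rotate1)

lemma star_least_symmetrized:
  assumes "\<forall>r\<in>R. cyc_reduced r"
  shows "symmetrized (star R)" "R \<subseteq> star R"
    and "symmetrized S \<Longrightarrow> R \<subseteq> S \<Longrightarrow> star R \<subseteq> S"
proof -
  have "cyc_reduced w" if "w \<in> star R" for w
    using that assms by induction (auto intro: cyc_reduced_winv cyc_reduced_rotate)
  then show "symmetrized (star R)"
    by (auto simp: symmetrized_def intro: star.winv star.rotate)
  show "R \<subseteq> star R" by (auto intro: star.base)
  show "star R \<subseteq> S" if "symmetrized S" "R \<subseteq> S"
  proof
    fix w assume "w \<in> star R"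
    then show "w \<in> S" using that by induction (auto simp: symmetrized_def)
  qed
qed

section \<open>The random generator\<close>

definition elem_identities :: "'a set \<Rightarrow> 'a gword set \<Rightarrow> 'a gword set" where
  "elem_identities X R = {[a, linv a] | a. a \<in> X \<times> UNIV} \<union> R"

definition rand_transformation :: "'a gword pmf \<Rightarrow> 'a gword \<Rightarrow> 'a gword pmf" where
  "rand_transformation PI v = do {
     u \<leftarrow> PI;
     p \<leftarrow> pmf_of_set {0..length v};
     return_pmf (take p v @ u @ drop p v)
   }"

definition rsw2_step ::
  "'a gword set \<Rightarrow> real \<Rightarrow> 'a gword pmf \<Rightarrow> 'a gword pmf \<Rightarrow> 'a gword \<Rightarrow> 'a gword pmf" where
  "rsw2_step H q PI PH w =
     (if H = {} then rand_transformation PI w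
      else do {
        b \<leftarrow> bernoulli_pmf q;
        if b then map_pmf (\<lambda>u. w @ u) PH else rand_transformation PI w
      })"

primrec rsw2_word ::
  "'a gword set \<Rightarrow> real \<Rightarrow> 'a gword pmf \<Rightarrow> 'a gword pmf \<Rightarrow> nat \<Rightarrow> 'a gword pmf" where
  "rsw2_word H q PI PH 0 = return_pmf []"
| "rsw2_word H q PI PH (Suc i) = rsw2_word H q PI PH i \<bind> rsw2_step H q PI PH"

definition RandomSubgroupWord2 ::
  "'a gword set \<Rightarrow> real \<Rightarrow> 'a gword pmf \<Rightarrow> 'a gword pmf \<Rightarrow> nat \<Rightarrow> 'a gword pmf" where
  "RandomSubgroupWord2 H q PI PH n = map_pmf freduce (rsw2_word H q PI PH n)"

section \<open>Labelled digraphs, completion and folding\<close>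

text \<open>
  A name space for vertices: \<open>Fresh u v w j\<close> is the \<open>j\<close>-th interior vertex of an arc from \<open>u\<close>
  to \<open>v\<close> labelled \<open>w\<close>. Wrapping existing vertices in \<open>Old\<close> before attaching arcs keeps the
  interior vertices of these arcs distinct from all existing vertices.
\<close>

datatype 'a vertex = Base | End | Old "'a vertex" | Fresh "'a vertex" "'a vertex" "'a gword" nat

record 'a xgraph =
  verts :: "'a vertex set"
  edges :: "('a vertex \<times> 'a \<times> 'a vertex) set"
  start :: "'a vertex"
  finish :: "'a vertex"

definition size_graph :: "'a xgraph \<Rightarrow> nat" where
  "size_graph \<Gamma> = card (verts \<Gamma>) + card (edges \<Gamma>)"

definition finite_graph :: "'a xgraph \<Rightarrow> bool" where
  "finite_graph \<Gamma> \<longleftrightarrow> finite (verts \<Gamma>) \<and> finite (edges \<Gamma>)"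

definition arc_node :: "'a vertex \<Rightarrow> 'a vertex \<Rightarrow> 'a gword \<Rightarrow> nat \<Rightarrow> 'a vertex" where
  "arc_node u v w j = (if j = 0 then u else if j = length w then v else Fresh u v w j)"

definition letter_edge :: "'a vertex \<Rightarrow> 'a letter \<Rightarrow> 'a vertex \<Rightarrow> 'a vertex \<times> 'a \<times> 'a vertex" where
  "letter_edge u a v = (if snd a then (u, fst a, v) else (v, fst a, u))"

definition arc_verts :: "'a vertex \<Rightarrow> 'a vertex \<Rightarrow> 'a gword \<Rightarrow> 'a vertex set" where
  "arc_verts u v w = {arc_node u v w j | j. j \<le> length w}"

definition arc_edges ::
  "'a vertex \<Rightarrow> 'a vertex \<Rightarrow> 'a gword \<Rightarrow> ('a vertex \<times> 'a \<times> 'a vertex) set" where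
  "arc_edges u v w =
     {letter_edge (arc_node u v w j) (w ! j) (arc_node u v w (Suc j)) | j. j < length w}"

text \<open>The graph \<open>\<Gamma>\<^sub>0\<close>; if \<open>w\<close> is empty, its endpoint is the base vertex itself.\<close>

definition initial_graph :: "'a gword set \<Rightarrow> 'a gword \<Rightarrow> 'a xgraph" where
  "initial_graph H w =
     (let e = (if w = [] then Base else End) in
      \<lparr>verts = arc_verts Base e w \<union> (\<Union>h\<in>H. arc_verts Base Base h),
       edges = arc_edges Base e w \<union> (\<Union>h\<in>H. arc_edges Base Base h),
       start = Base, finish = e\<rparr>)"

definition completion :: "'a gword set \<Rightarrow> 'a xgraph \<Rightarrow> 'a xgraph" where
  "completion R \<Gamma> =
     \<lparr>verts = Old ` verts \<Gamma> \<union> (\<Union>v\<in>verts \<Gamma>. \<Union>r\<in>R. arc_verts (Old v) (Old v) r),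
      edges = (\<lambda>(u, x, v). (Old u, x, Old v)) ` edges \<Gamma>
                \<union> (\<Union>v\<in>verts \<Gamma>. \<Union>r\<in>R. arc_edges (Old v) (Old v) r),
      start = Old (start \<Gamma>), finish = Old (finish \<Gamma>)\<rparr>"

text \<open>
  Pairs of vertices that Stallings foldings identify: each fold merges two edges with the same
  label that (after the preceding folds) share their origin or their terminus. The outcome of
  folding until the graph is folded does not depend on the order of the folds.
\<close>

inductive_set fold_rel :: "'a xgraph \<Rightarrow> ('a vertex \<times> 'a vertex) set" for \<Gamma> where
  refl: "v \<in> verts \<Gamma> \<Longrightarrow> (v, v) \<in> fold_rel \<Gamma>"
| sym: "(u, v) \<in> fold_rel \<Gamma> \<Longrightarrow> (v, u) \<in> fold_rel \<Gamma>"
| trans: "(u, v) \<in> fold_rel \<Gamma> \<Longrightarrow> (v, w) \<in> fold_rel \<Gamma> \<Longrightarrow> (u, w) \<in> fold_rel \<Gamma>"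
| out: "(u, v) \<in> fold_rel \<Gamma> \<Longrightarrow> (u, x, u') \<in> edges \<Gamma> \<Longrightarrow> (v, x, v') \<in> edges \<Gamma>
          \<Longrightarrow> (u', v') \<in> fold_rel \<Gamma>"
| inc: "(u', v') \<in> fold_rel \<Gamma> \<Longrightarrow> (u, x, u') \<in> edges \<Gamma> \<Longrightarrow> (v, x, v') \<in> edges \<Gamma>
          \<Longrightarrow> (u, v) \<in> fold_rel \<Gamma>"

text \<open>
  The quotient by the equivalence relation \<open>fold_rel\<close>, with every class named after a chosen
  element of it: \<open>fold_rep \<Gamma> v\<close> depends only on the class of \<open>v\<close>.
\<close>

definition fold_rep :: "'a xgraph \<Rightarrow> 'a vertex \<Rightarrow> 'a vertex" where
  "fold_rep \<Gamma> v = (SOME u. u \<in> fold_rel \<Gamma> `` {v})"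

definition stallings :: "'a xgraph \<Rightarrow> 'a xgraph" where
  "stallings \<Gamma> =
     \<lparr>verts = fold_rep \<Gamma> ` verts \<Gamma>,
      edges = (\<lambda>(u, x, v). (fold_rep \<Gamma> u, x, fold_rep \<Gamma> v)) ` edges \<Gamma>,
      start = fold_rep \<Gamma> (start \<Gamma>), finish = fold_rep \<Gamma> (finish \<Gamma>)\<rparr>"

section \<open>The solver and its running time\<close>

text \<open>For a presentation with relators \<open>R\<close> the solver works with the symmetrized set \<open>star R\<close>.\<close>

primrec amp_graph :: "'a gword set \<Rightarrow> 'a gword set \<Rightarrow> 'a gword \<Rightarrow> nat \<Rightarrow> 'a xgraph" where
  "amp_graph R H w 0 = initial_graph H w"
| "amp_graph R H w (Suc i) = stallings (completion (star R) (amp_graph R H w i))"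

definition amp_stops :: "'a gword set \<Rightarrow> 'a gword set \<Rightarrow> 'a gword \<Rightarrow> nat \<Rightarrow> bool" where
  "amp_stops R H w i \<longleftrightarrow> start (amp_graph R H w i) = finish (amp_graph R H w i)"

definition amp_iterations :: "'a gword set \<Rightarrow> 'a gword set \<Rightarrow> 'a gword \<Rightarrow> nat" where
  "amp_iterations R H w = (LEAST i. amp_stops R H w i)"

text \<open>The class of functions that are \<open>n\<^sup>c\<close> up to polylogarithmic factors.\<close>

definition soft_O :: "real \<Rightarrow> (nat \<Rightarrow> real) set" where
  "soft_O c = (\<Union>k::nat. O(\<lambda>n. real n powr c * ln (real n) ^ k))"

definition nearly_linear :: "('a xgraph \<Rightarrow> nat) \<Rightarrow> bool" where
  "nearly_linear t \<longleftrightarrow>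
     (\<exists>f\<in>soft_O 1. \<forall>\<Gamma>. finite_graph \<Gamma> \<longrightarrow> real (t \<Gamma>) \<le> f (size_graph \<Gamma>))"

text \<open>
  The running time is that of the solver with its two subroutines charged separately:
  \<open>write_time \<Gamma>\<close> steps for setting up the graph \<open>\<Gamma>\<close> in memory, either as initial graph or by
  adding loops to the current graph, \<open>fold_time \<Gamma>\<close> steps for the Stallings folding of \<open>\<Gamma>\<close>, and
  one step for each test of the loop condition. It is infinite if the solver does not terminate.
\<close>

definition amp_time ::
  "('a xgraph \<Rightarrow> nat) \<Rightarrow> ('a xgraph \<Rightarrow> nat) \<Rightarrow> 'a gword set \<Rightarrow> 'a gword set \<Rightarrow> 'a gword \<Rightarrow> enat"
where
  "amp_time write_time fold_time R H w =
     (if \<exists>i. amp_stops R H w i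
      then enat (write_time (initial_graph H w) + 1 +
             (\<Sum>i<amp_iterations R H w.
                let \<Delta> = completion (star R) (amp_graph R H w i)
                in write_time \<Delta> + fold_time \<Delta> + 1))
      else \<infinity>)"

end

theory Submission
  imports Defs
begin

text \<open>
  Every word \<open>w\<^sub>n\<close> is a product of elements of \<open>H\<^sup>\<plusminus>\<close> and of nested insertions of relators and
  trivial words. If the nesting depth is less than \<open>N\<close>, then in the \<open>N\<close>-th graph of the solver
  \<open>w\<^sub>n\<close> can be read as a closed path at the base vertex: each iteration makes the insertions of
  one more level readable. The graph being folded, the reduced word \<open>w'\<close> is then read along the
  same closed path, so the solver stops after at most \<open>N\<close> iterations. Letters that occur in no
  relator need not be readable in the graph; this is repaired by attaching hair to it.

  The exponential moment \<open>\<Sum> e^depth\<close> over the gaps of the word, divided by the \<open>e\<close>-th power of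
  the number of gaps, is a supermartingale, so by Markov's inequality the depth is less than
  \<open>c ln n\<close> with probability tending to 1, for each \<open>c > e\<close>. Each iteration multiplies the number of
  vertices by at most \<open>\<beta> = 1 + 2L(L-1)\<close> with \<open>L = L(R)\<close>, because the symmetrized set has at most
  \<open>2|r|\<close> elements for each relator \<open>r\<close>. Since \<open>\<beta> \<le> L^(5/2)\<close>, the choice \<open>c = 2e^2/5\<close>, which
  exceeds \<open>e\<close>, bounds the total growth \<open>\<beta>^(c ln n)\<close> by \<open>n^(e^2 ln L)\<close>.
\<close>

section \<open>Runs of transition systems\<close>

text \<open>The step relation is a parameter so that conditions on the visited states, such as
  \<open>complete\<close> or \<open>good\<close>, can be carried along a run by conjoining them to
  it.\<close>

fun run :: "('l \<Rightarrow> 's \<Rightarrow> 's \<Rightarrow> bool) \<Rightarrow> 's \<Rightarrow> 'l list \<Rightarrow> 's \<Rightarrow> bool" where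
  "run T s [] s' \<longleftrightarrow> s = s'"
| "run T s (a # w) s' \<longleftrightarrow> (\<exists>s1. T a s s1 \<and> run T s1 w s')"

lemma run_append: "run T s (u @ v) s' \<longleftrightarrow> (\<exists>m. run T s u m \<and> run T m v s')"
  by (induction u arbitrary: s) auto

lemma run_hom:
  assumes "run T s w s'" "\<And>a x y. a \<in> set w \<Longrightarrow> T a x y \<Longrightarrow> T' a (f x) (f y)"
  shows "run T' (f s) w (f s')"
  using assms
proof (induction w arbitrary: s)
  case (Cons a w)
  from Cons.prems obtain s1 where s1: "T a s s1" "run T s1 w s'" by auto
  moreover have "T' a (f s) (f s1)" using Cons.prems(2) s1(1) by simp
  moreover have "run T' (f s1) w (f s')" using Cons.IH[OF s1(2)] Cons.prems(2) by simp
  ultimately show ?case by auto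
qed auto

lemma run_mono:
  assumes "run T s w s'" "\<And>a x y. a \<in> set w \<Longrightarrow> T a x y \<Longrightarrow> T' a x y"
  shows "run T' s w s'"
  using run_hom[of T s w s' T' id] assms by auto

lemma run_stationary: "(\<And>a. a \<in> set w \<Longrightarrow> T a s s) \<Longrightarrow> run T s w s"
  by (induction w) auto

text \<open>Inverse automata: every letter acts as a partial injection and its formal inverse as the
  inverse partial injection.\<close>

definition inverse_system :: "('a letter \<Rightarrow> 's \<Rightarrow> 's \<Rightarrow> bool) \<Rightarrow> bool" where
  "inverse_system T \<longleftrightarrow> (\<forall>a s s'. T (linv a) s s' \<longleftrightarrow> T a s' s)
     \<and> (\<forall>a s s1 s2. T a s s1 \<longrightarrow> T a s s2 \<longrightarrow> s1 = s2)"

lemma run_unique: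
  assumes "inverse_system T" "run T s w s1" "run T s w s2"
  shows "s1 = s2"
  using assms(2,3)
proof (induction w arbitrary: s)
  case (Cons a w)
  then obtain t1 t2 where "T a s t1" "run T t1 w s1" "T a s t2" "run T t2 w s2" by auto
  with Cons.IH assms(1) show ?case by (metis inverse_system_def)
qed auto

text \<open>A letter followed by its inverse leads back to the state it was read from, so a
  cancellation removes two steps without moving the endpoints.\<close>

lemma run_freduce:
  assumes "inverse_system T" "run T s w s'"
  shows "run T s (freduce w) s'"
  using assms(2)
proof (induction w arbitrary: s)
  case (Cons a w)
  then obtain s1 where s1: "T a s s1" "run T s1 (freduce w) s'" by auto
  have eq: "freduce (a # w) = cancel_cons a (freduce w)" by (simp add: freduce_def)
  show ?case
  proof (cases "freduce w")
    case Nil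
    with s1 eq show ?thesis by simp
  next
    case (Cons b v)
    show ?thesis
    proof (cases "b = linv a")
      case True
      with Cons s1(2) obtain s2 where s2: "T (linv a) s1 s2" "run T s2 v s'" by auto
      moreover have "T (linv a) s1 s" using s1(1) assms(1) unfolding inverse_system_def by blast
      ultimately have "s2 = s" using assms(1) by (meson inverse_system_def)
      with s2 eq Cons True show ?thesis by simp
    next
      case False
      with s1 eq Cons show ?thesis by auto
    qed
  qed
qed (simp add: freduce_def)

lemma run_winv:
  assumes "\<And>a s s'. T (linv a) s s' \<longleftrightarrow> T a s' s"
  shows "run T s (winv w) s' \<longleftrightarrow> run T s' w s"
  by (induction w arbitrary: s') (auto simp: winv_def run_append assms)

section \<open>The symmetrized set\<close>

lemma winv_append: "winv (u @ v) = winv v @ winv u"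
  by (simp add: winv_def)

lemma length_winv [simp]: "length (winv w) = length w"
  by (simp add: winv_def)

lemma winv_rotate: "\<exists>k. winv (rotate j w) = rotate k (winv w)"
proof -
  let ?u = "take (j mod length w) w" and ?v = "drop (j mod length w) w"
  have "winv (rotate j w) = winv ?u @ winv ?v"
    by (simp add: rotate_drop_take winv_append)
  also have "\<dots> = rotate (length (winv ?v)) (winv ?v @ winv ?u)"
    by (simp only: rotate_append)
  also have "winv ?v @ winv ?u = winv w"
    by (simp only: winv_append[symmetric] append_take_drop_id)
  finally show ?thesis by blast
qed

text \<open>Inverting a rotation gives a rotation of the inverse (\<open>winv_rotate\<close>), so
  one optional inversion followed by one rotation exhausts the closure.\<close>

lemma star_rotateE:
  assumes "s \<in> star R"
  shows "\<exists>r\<in>R. \<exists>k. s = rotate k r \<or> s = rotate k (winv r)"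
  using assms
proof induction
  case (base r)
  then show ?case by (intro bexI[of _ r] exI[of _ 0]) auto
next
  case (winv s)
  then obtain r k where r: "r \<in> R" "s = rotate k r \<or> s = rotate k (winv r)" by blast
  then show ?case using winv_rotate[of k r] winv_rotate[of k "winv r"] by auto
next
  case (rotate s k)
  then show ?case by (metis rotate_rotate)
qed

text \<open>The separate \<open>w\<close> stands for rotation by 0 and also covers the empty word,
  whose index range is empty.\<close>

definition rotations :: "'a list \<Rightarrow> 'a list set" where
  "rotations w = insert w ((\<lambda>k. rotate k w) ` {1..<length w})"

lemma rotate_in_rotations: "rotate k w \<in> rotations w"
proof (cases "k mod length w = 0 \<or> w = []")
  case True
  then have "rotate k w = w" by (auto simp: rotate_drop_take)
  then show ?thesis by (simp add: rotations_def)
next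
  case False
  then have "k mod length w \<in> {1..<length w}" by auto
  moreover have "rotate k w = rotate (k mod length w) w" by (rule rotate_conv_mod)
  ultimately show ?thesis unfolding rotations_def by blast
qed

lemma card_rotations: "finite (rotations w)" "card (rotations w) \<le> max 1 (length w)"
proof -
  show "finite (rotations w)" by (simp add: rotations_def)
  have "card (rotations w) \<le> Suc (card ((\<lambda>k. rotate k w) ` {1..<length w}))"
    unfolding rotations_def by (rule card_insert_le_m1) auto
  also have "\<dots> \<le> Suc (length w - 1)" using card_image_le[of "{1..<length w}" "\<lambda>k. rotate k w"] by simp
  finally show "card (rotations w) \<le> max 1 (length w)" by simp
qed

lemma length_rotations: "v \<in> rotations w \<Longrightarrow> length v = length w"
  by (auto simp: rotations_def)

lemma star_subset: "star R \<subseteq> (\<Union>r\<in>R. rotations r \<union> rotations (winv r))"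
proof
  fix s assume "s \<in> star R"
  from star_rotateE[OF this] show "s \<in> (\<Union>r\<in>R. rotations r \<union> rotations (winv r))"
    using rotate_in_rotations by blast
qed

lemma finite_star: "finite R \<Longrightarrow> finite (star R)"
  by (rule finite_subset[OF star_subset]) (simp add: card_rotations)

text \<open>The factor by which a completion can multiply the number of vertices: the vertex itself
  and, for each loop attached to it, the interior vertices of the loop.\<close>

definition growth :: "'a gword set \<Rightarrow> nat" where
  "growth R = 1 + (\<Sum>s\<in>star R. length s - 1)"

lemma sum_rotations_le:
  assumes "length u = length w"
  shows "(\<Sum>s\<in>rotations u. length s - 1) \<le> length w * (length w - 1)"
proof -
  have "(\<Sum>s\<in>rotations u. length s - 1) = card (rotations u) * (length w - 1)"
    using length_rotations[of _ u] assms by simp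
  also have "\<dots> \<le> max 1 (length w) * (length w - 1)"
    using card_rotations(2)[of u] assms by (intro mult_le_mono1) simp
  also have "\<dots> = length w * (length w - 1)" by (cases "length w") auto
  finally show ?thesis .
qed

text \<open>The rotations of \<open>r\<close> and those of its inverse contribute at most
  \<open>length r * (length r - 1)\<close> each. Replacing the second factor by
  \<open>total_length R - 1\<close> lets the first sum up to \<open>total_length R\<close>.\<close>

lemma growth_le:
  assumes "finite R"
  shows "growth R \<le> 1 + 2 * (total_length R * (total_length R - 1))"
proof -
  let ?f = "\<lambda>s. length s - 1" and ?L = "total_length R"
  have fin: "finite (\<Union>r\<in>R. rotations r \<union> rotations (winv r))"
    using assms by (simp add: card_rotations)
  have "sum ?f (star R) \<le> sum ?f (\<Union>r\<in>R. rotations r \<union> rotations (winv r))"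
    by (rule sum_mono2[OF fin star_subset]) simp
  \<comment> \<open>The pairs \<open>(r, s)\<close> count every word of the union at least once;
    \<open>snd\<close> projects them to the words.\<close>
  also have "\<dots> \<le> (\<Sum>r\<in>R. sum ?f (rotations r \<union> rotations (winv r)))"
    by (rule sum_le_included[where i=snd and t="Sigma R (\<lambda>r. rotations r \<union> rotations (winv r))", THEN order_trans])
       (use assms fin in \<open>auto simp: card_rotations sum.Sigma case_prod_beta\<close>)
  also have "\<dots> \<le> (\<Sum>r\<in>R. 2 * (length r * (?L - 1)))"
  proof (rule sum_mono)
    fix r assume "r \<in> R"
    then have len: "length r \<le> ?L"
      unfolding total_length_def using assms by (simp add: member_le_sum)
    have "sum ?f (rotations r \<union> rotations (winv r))
            \<le> sum ?f (rotations r) + sum ?f (rotations (winv r))"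
      using sum.union_inter[of "rotations r" "rotations (winv r)" ?f] by (simp add: card_rotations)
    also have "\<dots> \<le> 2 * (length r * (length r - 1))"
      using sum_rotations_le[of r r] sum_rotations_le[of "winv r" r] by simp
    also have "\<dots> \<le> 2 * (length r * (?L - 1))" using len by (intro mult_le_mono diff_le_mono) auto
    finally show "sum ?f (rotations r \<union> rotations (winv r)) \<le> 2 * (length r * (?L - 1))" .
  qed
  also have "\<dots> = 2 * (?L * (?L - 1))"
    by (simp add: total_length_def sum_distrib_left sum_distrib_right)
  finally show ?thesis by (simp add: growth_def)
qed

section \<open>Folding and completion\<close>

definition wf_graph :: "'a xgraph \<Rightarrow> bool" where
  "wf_graph \<Gamma> \<longleftrightarrow> start \<Gamma> \<in> verts \<Gamma> \<and> finish \<Gamma> \<in> verts \<Gamma> \<and>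
     (\<forall>(u, x, v) \<in> edges \<Gamma>. u \<in> verts \<Gamma> \<and> v \<in> verts \<Gamma>)"

definition estep :: "'a xgraph \<Rightarrow> 'a letter \<Rightarrow> 'a vertex \<Rightarrow> 'a vertex \<Rightarrow> bool" where
  "estep \<Gamma> a u v \<longleftrightarrow> letter_edge u a v \<in> edges \<Gamma>"

lemma letter_edge_linv: "letter_edge u (linv a) v = letter_edge v a u"
  by (simp add: letter_edge_def linv_def)

lemma estep_linv: "estep \<Gamma> (linv a) u v \<longleftrightarrow> estep \<Gamma> a v u"
  by (simp add: estep_def letter_edge_linv)

lemma estep_verts: "wf_graph \<Gamma> \<Longrightarrow> estep \<Gamma> a u v \<Longrightarrow> u \<in> verts \<Gamma> \<and> v \<in> verts \<Gamma>"
  by (auto simp: wf_graph_def estep_def letter_edge_def split: if_splits)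

lemma estep_hom:
  assumes "\<And>u x v. (u, x, v) \<in> edges \<Gamma> \<Longrightarrow> (f u, x, f v) \<in> edges \<Gamma>'" "estep \<Gamma> a u v"
  shows "estep \<Gamma>' a (f u) (f v)"
  using assms by (auto simp: estep_def letter_edge_def)

lemma fold_rep_eq_iff:
  assumes "u \<in> verts \<Gamma>" "v \<in> verts \<Gamma>"
  shows "fold_rep \<Gamma> u = fold_rep \<Gamma> v \<longleftrightarrow> (u, v) \<in> fold_rel \<Gamma>"
proof
  have rep: "(z, fold_rep \<Gamma> z) \<in> fold_rel \<Gamma>" if "z \<in> verts \<Gamma>" for z
    unfolding fold_rep_def using someI[of "\<lambda>u. u \<in> fold_rel \<Gamma> `` {z}" z] that
    by (auto intro: fold_rel.refl)
  assume "fold_rep \<Gamma> u = fold_rep \<Gamma> v"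
  then have "(fold_rep \<Gamma> u, v) \<in> fold_rel \<Gamma>" using rep[OF assms(2)] by (auto intro: fold_rel.sym)
  with rep[OF assms(1)] show "(u, v) \<in> fold_rel \<Gamma>" by (rule fold_rel.trans)
next
  assume "(u, v) \<in> fold_rel \<Gamma>"
  then have "fold_rel \<Gamma> `` {u} = fold_rel \<Gamma> `` {v}"
    by (auto intro: fold_rel.sym fold_rel.trans)
  then show "fold_rep \<Gamma> u = fold_rep \<Gamma> v" by (simp add: fold_rep_def)
qed

lemma edges_stallings:
  "(u, x, v) \<in> edges \<Gamma> \<Longrightarrow> (fold_rep \<Gamma> u, x, fold_rep \<Gamma> v) \<in> edges (stallings \<Gamma>)"
  by (force simp: stallings_def)

lemma estep_stallings:
  "estep \<Gamma> a u v \<Longrightarrow> estep (stallings \<Gamma>) a (fold_rep \<Gamma> u) (fold_rep \<Gamma> v)"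
  by (rule estep_hom[OF edges_stallings])

lemma verts_stallings: "v \<in> verts \<Gamma> \<Longrightarrow> fold_rep \<Gamma> v \<in> verts (stallings \<Gamma>)"
  by (simp add: stallings_def)

lemma wf_stallings: "wf_graph \<Gamma> \<Longrightarrow> wf_graph (stallings \<Gamma>)"
  unfolding wf_graph_def stallings_def by auto

text \<open>The rules \<open>out\<close> and \<open>inc\<close> of \<open>fold_rel\<close> are
  determinism of the quotient, forwards and backwards. Well-formedness places the ends of edges
  among the vertices, where equal representatives mean related vertices.\<close>

lemma inverse_system_stallings:
  assumes "wf_graph \<Gamma>"
  shows "inverse_system (estep (stallings \<Gamma>))"
  unfolding inverse_system_def
proof (intro conjI allI impI)
  show "estep (stallings \<Gamma>) (linv a) s s' = estep (stallings \<Gamma>) a s' s" for a s s'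
    by (rule estep_linv)
  have wf: "u \<in> verts \<Gamma> \<and> v \<in> verts \<Gamma>" if "(u, x, v) \<in> edges \<Gamma>" for u x v
    using assms that by (auto simp: wf_graph_def)
  show "s1 = s2" if "estep (stallings \<Gamma>) a s s1" "estep (stallings \<Gamma>) a s s2" for a s s1 s2
  proof (cases "snd a")
    case True
    with that obtain u u' v v' where e: "(u, fst a, u') \<in> edges \<Gamma>" "(v, fst a, v') \<in> edges \<Gamma>"
      "s = fold_rep \<Gamma> u" "s = fold_rep \<Gamma> v" "s1 = fold_rep \<Gamma> u'" "s2 = fold_rep \<Gamma> v'"
      by (auto simp: estep_def letter_edge_def stallings_def)
    with wf have "(u, v) \<in> fold_rel \<Gamma>" by (metis fold_rep_eq_iff)
    then have "(u', v') \<in> fold_rel \<Gamma>" using e by (blast intro: fold_rel.out)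
    with e wf show ?thesis by (metis fold_rep_eq_iff)
  next
    case False
    with that obtain u u' v v' where e: "(u, fst a, u') \<in> edges \<Gamma>" "(v, fst a, v') \<in> edges \<Gamma>"
      "s = fold_rep \<Gamma> u'" "s = fold_rep \<Gamma> v'" "s1 = fold_rep \<Gamma> u" "s2 = fold_rep \<Gamma> v"
      by (auto simp: estep_def letter_edge_def stallings_def)
    with wf have "(u', v') \<in> fold_rel \<Gamma>" by (metis fold_rep_eq_iff)
    then have "(u, v) \<in> fold_rel \<Gamma>" using e by (blast intro: fold_rel.inc)
    with e wf show ?thesis by (metis fold_rep_eq_iff)
  qed
qed

section \<open>Arcs read their labels; well-formedness of the graphs\<close>

lemma run_states:
  "(\<And>j. j < length w \<Longrightarrow> T (w ! j) (f j) (f (Suc j))) \<Longrightarrow> run T (f 0) w (f (length w))"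
proof (induction w arbitrary: f)
  case (Cons a w)
  have "run T (f (Suc 0)) w (f (Suc (length w)))"
  proof (rule Cons.IH[of "\<lambda>j. f (Suc j)"])
    show "T (w ! j) (f (Suc j)) (f (Suc (Suc j)))" if "j < length w" for j
      using Cons.prems[of "Suc j"] that by simp
  qed
  moreover have "T a (f 0) (f (Suc 0))" using Cons.prems[of 0] by simp
  ultimately show ?case by auto
qed simp

text \<open>Recording the vertices passed makes it possible to speak later of their completeness. An
  empty arc is the single node \<open>u\<close>, whence the hypothesis.\<close>

lemma run_arc:
  assumes "w = [] \<Longrightarrow> u = v"
  shows "run (\<lambda>a x y. letter_edge x a y \<in> arc_edges u v w \<and> y \<in> arc_verts u v w) u w v"
proof -
  let ?T = "\<lambda>a x y. letter_edge x a y \<in> arc_edges u v w \<and> y \<in> arc_verts u v w"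
  have "run ?T (arc_node u v w 0) w (arc_node u v w (length w))"
  proof (rule run_states)
    show "?T (w ! j) (arc_node u v w j) (arc_node u v w (Suc j))" if "j < length w" for j
      using that Suc_leI unfolding arc_edges_def arc_verts_def by blast
  qed
  then show ?thesis using assms by (cases "w = []") (simp_all add: arc_node_def)
qed

lemma arc_edges_verts:
  "(x, l, y) \<in> arc_edges u v w \<Longrightarrow> x \<in> arc_verts u v w \<and> y \<in> arc_verts u v w"
proof -
  assume "(x, l, y) \<in> arc_edges u v w"
  then obtain j where j: "j < length w"
    "(x, l, y) = letter_edge (arc_node u v w j) (w ! j) (arc_node u v w (Suc j))"
    unfolding arc_edges_def by blast
  then have "arc_node u v w j \<in> arc_verts u v w" "arc_node u v w (Suc j) \<in> arc_verts u v w"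
    unfolding arc_verts_def by (blast intro: less_imp_le Suc_leI)+
  with j(2) show ?thesis by (auto simp: letter_edge_def split: if_splits)
qed

lemma start_in_arc_verts: "u \<in> arc_verts u v w"
  unfolding arc_verts_def arc_node_def by (auto intro!: exI[of _ "0::nat"])

lemma finish_in_arc_verts: "w \<noteq> [] \<Longrightarrow> v \<in> arc_verts u v w"
  unfolding arc_verts_def arc_node_def by (auto intro!: exI[of _ "length w"])

lemma wf_completion: "wf_graph \<Gamma> \<Longrightarrow> wf_graph (completion S \<Gamma>)"
  unfolding wf_graph_def completion_def by (auto dest: arc_edges_verts)

lemma wf_initial: "wf_graph (initial_graph H w)"
  unfolding wf_graph_def initial_graph_def Let_def
  by (auto dest: arc_edges_verts simp: start_in_arc_verts finish_in_arc_verts)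

lemma wf_amp: "wf_graph (amp_graph R H w i)"
  by (induction i) (auto intro: wf_initial wf_stallings wf_completion)

text \<open>The level \<open>j\<close> counts how deeply insertions of relators may be nested at
  \<open>u\<close>: a loop at \<open>u\<close> spends one level, and insertions at the vertices
  along it can use what is left.\<close>

primrec complete :: "'a gword set \<Rightarrow> 'a xgraph \<Rightarrow> nat \<Rightarrow> 'a vertex \<Rightarrow> bool" where
  "complete S \<Gamma> 0 u \<longleftrightarrow> True"
| "complete S \<Gamma> (Suc j) u \<longleftrightarrow> (\<forall>r\<in>S. run (\<lambda>a x y. estep \<Gamma> a x y \<and> complete S \<Gamma> j y) u r u)"

lemma complete_SucD: "complete S \<Gamma> (Suc j) u \<Longrightarrow> complete S \<Gamma> j u"
proof (induction j arbitrary: u)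
  case (Suc j)
  show ?case
    unfolding complete.simps(2)[of S \<Gamma> j]
  proof
    fix r assume "r \<in> S"
    with Suc.prems have "run (\<lambda>a x y. estep \<Gamma> a x y \<and> complete S \<Gamma> (Suc j) y) u r u"
      unfolding complete.simps(2)[of S \<Gamma> "Suc j"] by blast
    then show "run (\<lambda>a x y. estep \<Gamma> a x y \<and> complete S \<Gamma> j y) u r u"
      by (rule run_mono) (use Suc.IH in blast)
  qed
qed simp

lemma complete_mono: "i \<le> j \<Longrightarrow> complete S \<Gamma> j u \<Longrightarrow> complete S \<Gamma> i u"
  by (induction j rule: dec_induct) (auto dest: complete_SucD simp del: complete.simps)

section \<open>Natural maps between the graphs of the solver\<close>

context
  fixes R H :: "'a gword set" and w :: "'a gword"
begin

text \<open>The natural map from one graph to the next: inclusion into the completion, then the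
  folding quotient.\<close>

definition lift :: "nat \<Rightarrow> 'a vertex \<Rightarrow> 'a vertex" where
  "lift i v = fold_rep (completion (star R) (amp_graph R H w i)) (Old v)"

primrec embed :: "nat \<Rightarrow> nat \<Rightarrow> 'a vertex \<Rightarrow> 'a vertex" where
  "embed m 0 v = v"
| "embed m (Suc k) v = lift (m + k) (embed m k v)"

lemma embed_Suc_left: "embed m (Suc k) v = embed (Suc m) k (lift m v)"
  by (induction k) auto

lemma lift_edges:
  "(u, x, v) \<in> edges (amp_graph R H w i) \<Longrightarrow>
     (lift i u, x, lift i v) \<in> edges (amp_graph R H w (Suc i))"
  unfolding lift_def amp_graph.simps
  by (rule edges_stallings) (force simp: completion_def)

lemma embed_edges:
  "(u, x, v) \<in> edges (amp_graph R H w m) \<Longrightarrow>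
     (embed m k u, x, embed m k v) \<in> edges (amp_graph R H w (m + k))"
  by (induction k) (use lift_edges in auto)

lemma embed_start: "embed m k (start (amp_graph R H w m)) = start (amp_graph R H w (m + k))"
  by (induction k) (simp_all add: lift_def stallings_def completion_def)

lemma embed_finish: "embed m k (finish (amp_graph R H w m)) = finish (amp_graph R H w (m + k))"
  by (induction k) (simp_all add: lift_def stallings_def completion_def)

text \<open>The first iteration attaches all relator loops at \<open>v\<close>. Their vertices
  belong to the next graph, so by induction the remaining iterations give them one level less.
  \<open>embed_Suc_left\<close> splits off that first iteration.\<close>

lemma complete_embed:
  "v \<in> verts (amp_graph R H w m) \<Longrightarrow> complete (star R) (amp_graph R H w (m + k)) k (embed m k v)"
proof (induction k arbitrary: m v)
  case (Suc k)
  let ?\<Gamma> = "amp_graph R H w" and ?\<Delta> = "completion (star R) (amp_graph R H w m)"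
  have "run (\<lambda>a x y. estep (?\<Gamma> (m + Suc k)) a x y \<and> complete (star R) (?\<Gamma> (m + Suc k)) k y)
          (embed m (Suc k) v) r (embed m (Suc k) v)" if "r \<in> star R" for r
  proof -
    have "run (\<lambda>a x y. letter_edge x a y \<in> arc_edges (Old v) (Old v) r
            \<and> y \<in> arc_verts (Old v) (Old v) r) (Old v) r (Old v)"
      by (rule run_arc) simp
    then have "run (\<lambda>a x y. estep ?\<Delta> a x y \<and> y \<in> verts ?\<Delta>) (Old v) r (Old v)"
      by (rule run_mono) (use Suc.prems that in \<open>auto simp: estep_def completion_def\<close>)
    then have "run (\<lambda>a x y. estep (?\<Gamma> (Suc m)) a x y \<and> y \<in> verts (?\<Gamma> (Suc m)))
                 (lift m v) r (lift m v)"
      unfolding lift_def by (rule run_hom) (simp add: estep_stallings verts_stallings)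
    then have "run (\<lambda>a x y. estep (?\<Gamma> (Suc m + k)) a x y \<and> complete (star R) (?\<Gamma> (Suc m + k)) k y)
                 (embed (Suc m) k (lift m v)) r (embed (Suc m) k (lift m v))"
      by (rule run_hom) (metis Suc.IH estep_hom embed_edges)
    then show ?thesis by (simp only: embed_Suc_left add_Suc add_Suc_right)
  qed
  then show ?case by (simp only: complete.simps) blast
qed simp

text \<open>Completion adds only edges labelled by letters of relators, so every other edge descends
  from the initial graph. By \<open>complete_embed\<close> its endpoints are then complete to level
  \<open>i\<close>.\<close>

lemma free_edges_initial:
  assumes "(u, x, v) \<in> edges (amp_graph R H w i)" "\<And>r b. r \<in> star R \<Longrightarrow> b \<in> set r \<Longrightarrow> fst b \<noteq> x"
  shows "u \<in> embed 0 i ` verts (initial_graph H w) \<and> v \<in> embed 0 i ` verts (initial_graph H w)"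
  using assms(1)
proof (induction i arbitrary: u v)
  case 0
  then show ?case using wf_initial[of H w] by (auto simp: wf_graph_def)
next
  case (Suc i)
  let ?\<Delta> = "completion (star R) (amp_graph R H w i)"
  from Suc.prems obtain u' v' where uv: "(u', x, v') \<in> edges ?\<Delta>"
    "u = fold_rep ?\<Delta> u'" "v = fold_rep ?\<Delta> v'"
    by (auto simp: stallings_def)
  have "(u', x, v') \<notin> arc_edges p q r" if "r \<in> star R" for p q r
  proof
    assume "(u', x, v') \<in> arc_edges p q r"
    then obtain j where "j < length r" "x = fst (r ! j)"
      by (auto simp: arc_edges_def letter_edge_def split: if_splits)
    with assms(2)[OF that, of "r ! j"] show False by simp
  qed
  with uv(1) obtain u0 v0 where "(u0, x, v0) \<in> edges (amp_graph R H w i)" "u' = Old u0" "v' = Old v0"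
    by (auto simp: completion_def)
  with Suc.IH uv show ?case by (force simp: lift_def)
qed

end

section \<open>Hair\<close>

text \<open>
  A folded graph is extended by hair: at a vertex \<open>p\<close> without an \<open>a\<close>-edge, where \<open>a\<close> is a letter
  that occurs in no relator, a tree over such letters is attached, its vertices being the pairs
  \<open>(p, t)\<close> with a reduced word \<open>t\<close> read from tip to root. All other letters act as loops on
  the hair, so that the relators close there for a trivial reason.
\<close>

definition occurs :: "'a gword set \<Rightarrow> 'a \<Rightarrow> bool" where
  "occurs S x \<longleftrightarrow> (\<exists>r\<in>S. \<exists>b\<in>set r. fst b = x)"

definition hair_ok :: "'a xgraph \<Rightarrow> 'a vertex \<Rightarrow> 'a gword \<Rightarrow> bool" where
  "hair_ok \<Gamma> p t \<longleftrightarrow> word_reduced t \<and> (t \<noteq> [] \<longrightarrow> \<not> (\<exists>q. estep \<Gamma> (last t) p q))"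

inductive hair_step ::
  "'a gword set \<Rightarrow> 'a xgraph \<Rightarrow> 'a letter \<Rightarrow> 'a vertex \<times> 'a gword \<Rightarrow> 'a vertex \<times> 'a gword \<Rightarrow> bool"
  for S \<Gamma> where
  edge: "estep \<Gamma> a p q \<Longrightarrow> hair_step S \<Gamma> a (p, []) (q, [])"
| loop: "occurs S (fst a) \<Longrightarrow> t \<noteq> [] \<Longrightarrow> hair_step S \<Gamma> a (p, t) (p, t)"
| push: "\<not> occurs S (fst a) \<Longrightarrow> hair_ok \<Gamma> p (a # t) \<Longrightarrow> hair_step S \<Gamma> a (p, t) (p, a # t)"
| pop: "\<not> occurs S (fst a) \<Longrightarrow> hair_ok \<Gamma> p (linv a # t) \<Longrightarrow> hair_step S \<Gamma> a (p, linv a # t) (p, t)"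

lemma fst_linv [simp]: "fst (linv a) = fst a"
  by (simp add: linv_def)

lemma linv_neq [simp]: "linv a \<noteq> a" "a \<noteq> linv a"
  by (auto simp: linv_def prod_eq_iff)

lemma hair_step_linvI: "hair_step S \<Gamma> a s s' \<Longrightarrow> hair_step S \<Gamma> (linv a) s' s"
proof (induction rule: hair_step.induct)
  case (push a p t)
  then show ?case using hair_step.pop[of S "linv a" \<Gamma> p t] by simp
qed (auto intro: hair_step.intros simp: estep_linv)

text \<open>At the root, \<open>edge\<close> and \<open>push\<close> exclude each other because hair
  starting with \<open>a\<close> grows only where there is no \<open>a\<close>-edge. On the hair,
  \<open>push\<close> and \<open>pop\<close> exclude each other because hair words are reduced, and
  \<open>loop\<close> takes only letters that those two refuse.\<close>

lemma inverse_system_hair_step: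
  assumes "inverse_system (estep \<Gamma>)"
  shows "inverse_system (hair_step S \<Gamma>)"
  unfolding inverse_system_def
proof (intro conjI allI impI)
  show "hair_step S \<Gamma> (linv a) s s' = hair_step S \<Gamma> a s' s" for a s s'
    using hair_step_linvI[of S \<Gamma> a s' s] hair_step_linvI[of S \<Gamma> "linv a" s s'] by auto
  have det: "q1 = q2" if "estep \<Gamma> a p q1" "estep \<Gamma> a p q2" for a p q1 q2
    using assms that by (meson inverse_system_def)
  have red: "\<not> hair_ok \<Gamma> p (a # linv a # t)" for a p t
    by (simp add: hair_ok_def reduced_Cons)
  show "s1 = s2" if "hair_step S \<Gamma> a s s1" "hair_step S \<Gamma> a s s2" for a s s1 s2
    using that
    by (auto elim!: hair_step.cases dest: det simp: red) (auto simp: hair_ok_def)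
qed

definition good :: "'a gword set \<Rightarrow> 'a xgraph \<Rightarrow> nat \<Rightarrow> 'a vertex \<times> 'a gword \<Rightarrow> bool" where
  "good S \<Gamma> j s \<longleftrightarrow> complete S \<Gamma> j (fst s) \<and> (snd s \<noteq> [] \<longrightarrow> hair_ok \<Gamma> (fst s) (snd s))"

lemma good_mono: "i \<le> j \<Longrightarrow> good S \<Gamma> j s \<Longrightarrow> good S \<Gamma> i s"
  by (auto simp: good_def intro: complete_mono)

text \<open>At the root this is \<open>complete\<close>; on the hair every letter of a relator
  stands still.\<close>

lemma good_relator:
  assumes "good S \<Gamma> (Suc j) s" "r \<in> S"
  shows "run (\<lambda>a x y. hair_step S \<Gamma> a x y \<and> good S \<Gamma> j y) s r s"
proof (cases "snd s = []")
  case True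
  then have "complete S \<Gamma> (Suc j) (fst s)" and s: "s = (fst s, [])"
    using assms by (auto simp: good_def prod_eq_iff)
  then have "run (\<lambda>a x y. estep \<Gamma> a x y \<and> complete S \<Gamma> j y) (fst s) r (fst s)"
    using assms(2) by auto
  then have "run (\<lambda>a x y. hair_step S \<Gamma> a x y \<and> good S \<Gamma> j y) (fst s, []) r (fst s, [])"
    by (rule run_hom) (auto intro: hair_step.edge simp: good_def)
  with s show ?thesis by simp
next
  case False
  then have "hair_step S \<Gamma> a s s" if "a \<in> set r" for a
    using hair_step.loop[of S a "snd s" \<Gamma> "fst s"] that assms(2) by (auto simp: occurs_def)
  moreover have "good S \<Gamma> j s" using assms(1) by (rule good_mono[rotated]) simp
  ultimately show ?thesis by (intro run_stationary) auto
qed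

text \<open>Closure under inverses turns the occurring letter into \<open>a\<close> itself, and a
  rotation brings it to the front.\<close>

lemma occurs_starE:
  assumes "occurs (star R) (fst a)"
  obtains v where "a # v \<in> star R"
proof -
  from assms obtain r b where r: "r \<in> star R" "b \<in> set r" "fst b = fst a" by (auto simp: occurs_def)
  then have "b = a \<or> b = linv a" by (auto simp: linv_def prod_eq_iff)
  then have "a \<in> set r \<or> a \<in> set (winv r)" using r(2) by (auto simp: set_winv) (metis imageI linv_linv)
  then obtain r' where r': "r' \<in> star R" "a \<in> set r'" using r(1) star.winv by blast
  then obtain u v where "r' = u @ a # v" by (meson split_list)
  then have "rotate (length u) r' = a # v @ u" by (simp add: rotate_append)
  with star.rotate[OF r'(1), of "length u"] show ?thesis using that by simp
qed

text \<open>A letter of relators starts a relator loop at the root and stands still on the hair. Any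
  other letter follows an edge, whose ends are controlled by \<open>free\<close>, or else grows or
  shortens the hair. Hence inserting \<open>[a, linv a]\<close> costs one level, like a
  relator.\<close>

lemma good_step:
  assumes "good (star R) \<Gamma> (Suc j) s"
    and free: "\<And>u x v. (u, x, v) \<in> edges \<Gamma> \<Longrightarrow> \<not> occurs (star R) x \<Longrightarrow>
                 complete (star R) \<Gamma> j u \<and> complete (star R) \<Gamma> j v"
  shows "\<exists>s1. hair_step (star R) \<Gamma> a s s1 \<and> good (star R) \<Gamma> j s1"
proof -
  obtain p t where s: "s = (p, t)" by (cases s)
  have pj: "complete (star R) \<Gamma> j p" and t: "t \<noteq> [] \<Longrightarrow> hair_ok \<Gamma> p t"
    using assms(1) s by (auto simp: good_def simp del: complete.simps dest: complete_SucD)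
  show ?thesis
  proof (cases "occurs (star R) (fst a)")
    case True
    show ?thesis
    proof (cases "t = []")
      case True
      obtain v where "a # v \<in> star R" using occurs_starE \<open>occurs (star R) (fst a)\<close> by blast
      then have "run (\<lambda>a x y. hair_step (star R) \<Gamma> a x y \<and> good (star R) \<Gamma> j y) s (a # v) s"
        by (rule good_relator[OF assms(1)])
      then show ?thesis by auto
    next
      case False
      with True s t pj show ?thesis
        by (intro exI[of _ s]) (auto intro: hair_step.loop simp: good_def)
    qed
  next
    case False
    show ?thesis
    proof (cases "t = []")
      case True
      show ?thesis
      proof (cases "\<exists>q. estep \<Gamma> a p q")
        case True
        then obtain q where q: "estep \<Gamma> a p q" ..
        then have "complete (star R) \<Gamma> j q"
          using free[OF _ False] by (auto simp: estep_def letter_edge_def split: if_splits)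
        with q s \<open>t = []\<close> show ?thesis
          by (intro exI[of _ "(q, [])"]) (auto intro: hair_step.edge simp: good_def)
      next
        case noedge: False
        then have "hair_ok \<Gamma> p [a]" by (simp add: hair_ok_def word_reduced_def)
        with False s pj \<open>t = []\<close> show ?thesis
          by (intro exI[of _ "(p, [a])"]) (auto intro: hair_step.push simp: good_def)
      qed
    next
      case tne: False
      then obtain b t' where bt: "t = b # t'" by (cases t) auto
      have ok: "hair_ok \<Gamma> p (b # t')" using t tne bt by simp
      show ?thesis
      proof (cases "b = linv a")
        case True
        have "hair_ok \<Gamma> p t'" if "t' \<noteq> []"
          using ok that by (simp add: hair_ok_def reduced_Cons)
        with True False s bt ok pj show ?thesis
          by (intro exI[of _ "(p, t')"]) (auto intro: hair_step.pop simp: good_def)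
      next
        case ba: False
        then have "hair_ok \<Gamma> p (a # b # t')"
          using ok by (simp add: hair_ok_def reduced_Cons)
        with False s bt pj show ?thesis
          by (intro exI[of _ "(p, a # b # t')"]) (auto intro: hair_step.push simp: good_def)
      qed
    qed
  qed
qed

lemma good_identity:
  assumes "good (star R) \<Gamma> (Suc j) s"
    and "\<And>u x v. (u, x, v) \<in> edges \<Gamma> \<Longrightarrow> \<not> occurs (star R) x \<Longrightarrow>
           complete (star R) \<Gamma> j u \<and> complete (star R) \<Gamma> j v"
  shows "run (\<lambda>a x y. hair_step (star R) \<Gamma> a x y \<and> good (star R) \<Gamma> j y) s [a, linv a] s"
proof -
  have "\<exists>s1. hair_step (star R) \<Gamma> a s s1 \<and> good (star R) \<Gamma> j s1"
    by (rule good_step[OF assms])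
  then obtain s1 where s1: "hair_step (star R) \<Gamma> a s s1" "good (star R) \<Gamma> j s1" by blast
  moreover have "good (star R) \<Gamma> j s" using assms(1) by (rule good_mono[rotated]) simp
  ultimately show ?thesis using hair_step_linvI[OF s1(1)] unfolding run.simps by blast
qed

section \<open>Words annotated with insertion depths\<close>

text \<open>
  Each letter carries the depth of the gap to its right, and the leftmost gap has depth 0.
  A word inserted into a gap of depth \<open>\<delta>\<close> leaves gaps of depth \<open>\<delta>\<close> on both sides of it,
  while its inner gaps are one level deeper.
\<close>

type_synonym 'a annotated = "('a letter \<times> nat) list"

definition gap_depth :: "'a annotated \<Rightarrow> nat" where
  "gap_depth W = (if W = [] then 0 else snd (last W))"

fun annotate :: "'a gword \<Rightarrow> nat \<Rightarrow> 'a annotated" where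
  "annotate [] \<delta> = []"
| "annotate [a] \<delta> = [(a, \<delta>)]"
| "annotate (a # b # u) \<delta> = (a, Suc \<delta>) # annotate (b # u) \<delta>"

definition ann_insert :: "'a annotated \<Rightarrow> 'a gword \<Rightarrow> nat \<Rightarrow> 'a annotated" where
  "ann_insert W u p = take p W @ annotate u (gap_depth (take p W)) @ drop p W"

text \<open>Appended factors get depth 0 throughout, since they are read along loops of the initial
  graph, whose vertices have the full level.\<close>

definition ann_append :: "'a annotated \<Rightarrow> 'a gword \<Rightarrow> 'a annotated" where
  "ann_append W u = W @ map (\<lambda>a. (a, 0)) u"

inductive ann_reach :: "'a gword set \<Rightarrow> 'a gword set \<Rightarrow> 'a annotated \<Rightarrow> bool" for I J where
  empty: "ann_reach I J []"
| insert: "ann_reach I J W \<Longrightarrow> u \<in> I \<Longrightarrow> ann_reach I J (ann_insert W u p)"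
| append: "ann_reach I J W \<Longrightarrow> u \<in> J \<Longrightarrow> ann_reach I J (ann_append W u)"

text \<open>The states inside \<open>u\<close> have level \<open>j\<close>, as the depth
  \<open>Suc \<delta>\<close> of the inner gaps requires. The last gap keeps the outer depth, and
  the hypothesis on \<open>s'\<close> supplies the higher level there.\<close>

lemma run_annotate:
  assumes "run (\<lambda>a x y. T a x y \<and> G j y) s u s'" "G (Suc j) s'" "N - \<delta> = Suc j"
  shows "run (\<lambda>(a, d) x y. T a x y \<and> G (N - d) y) s (annotate u \<delta>) s'"
  using assms(1,3)
proof (induction u \<delta> arbitrary: s rule: annotate.induct)
  case (2 a \<delta>)
  then show ?case using assms(2) by auto
next
  case (3 a b u \<delta>)
  from 3(2) obtain s1 where s1: "T a s s1" "G j s1" "run (\<lambda>a x y. T a x y \<and> G j y) s1 (b # u) s'"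
    by auto
  from 3(1)[OF s1(3) 3(3)] have "run (\<lambda>(a, d) x y. T a x y \<and> G (N - d) y) s1 (annotate (b # u) \<delta>) s'" .
  moreover have "N - Suc \<delta> = j" using 3(3) by simp
  ultimately show ?case using s1 by auto
qed auto


text \<open>Depth and level are complementary: the state in a gap of depth \<open>d\<close> still
  admits \<open>N - d\<close> levels of insertions.\<close>

definition ann_run ::
  "('l \<Rightarrow> 's \<Rightarrow> 's \<Rightarrow> bool) \<Rightarrow> (nat \<Rightarrow> 's \<Rightarrow> bool) \<Rightarrow> nat \<Rightarrow> 's \<Rightarrow> ('l \<times> nat) list \<Rightarrow> 's \<Rightarrow> bool" where
  "ann_run T G N = run (\<lambda>(a, d) x y. T a x y \<and> G (N - d) y)"

lemma ann_run_insert: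
  assumes run: "ann_run T G N s W s" and "G N s" and gap: "gap_depth (take p W) < N"
    and loop: "\<And>j m. Suc j \<le> N \<Longrightarrow> G (Suc j) m \<Longrightarrow> run (\<lambda>a x y. T a x y \<and> G j y) m u m"
  shows "ann_run T G N s (ann_insert W u p) s"
proof -
  let ?\<delta> = "gap_depth (take p W)"
  from run obtain m where m: "ann_run T G N s (take p W) m" "ann_run T G N m (drop p W) s"
    unfolding ann_run_def using run_append[of _ s "take p W" "drop p W" s]
    unfolding append_take_drop_id by blast
  \<comment> \<open>The leftmost gap has depth 0 and state \<open>s\<close>; the level at any other
    gap is recorded with the letter to its left.\<close>
  have "G (N - ?\<delta>) m"
  proof (cases "take p W" rule: rev_cases)
    case Nil
    with m(1) assms(2) show ?thesis by (simp add: ann_run_def gap_depth_def)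
  next
    case (snoc V c)
    with m(1) show ?thesis by (auto simp: ann_run_def run_append gap_depth_def case_prod_beta)
  qed
  moreover obtain j where j: "N - ?\<delta> = Suc j" using gap by (metis Suc_diff_Suc)
  ultimately have Gm: "G (Suc j) m" by simp
  from j have "Suc j \<le> N" by simp
  from run_annotate[where T=T and G=G, OF loop[OF this Gm] Gm j]
  have "ann_run T G N m (annotate u ?\<delta>) m" by (simp add: ann_run_def)
  with m show ?thesis unfolding ann_run_def ann_insert_def run_append by blast
qed

lemma ann_run_append:
  assumes "ann_run T G N s W s" "run (\<lambda>a x y. T a x y \<and> G N y) s u s"
  shows "ann_run T G N s (ann_append W u) s"
proof -
  have "run (\<lambda>(a, d) x y. T a x y \<and> G (N - d) y) s (map (\<lambda>a. (a, 0)) u) s'"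
    if "run (\<lambda>a x y. T a x y \<and> G N y) s u s'" for s s'
    using that by (induction u arbitrary: s) auto
  with assms show ?thesis unfolding ann_run_def ann_append_def run_append by blast
qed

text \<open>Old letters keep their depths, so a depth bound for the final word passes to all earlier
  ones.\<close>

lemma set_ann_insert: "set W \<subseteq> set (ann_insert W u p)"
  using append_take_drop_id[of p W] unfolding ann_insert_def
  by (metis Un_iff set_append subsetI)

lemma gap_depth_less:
  assumes "\<forall>(a, d)\<in>set W. d < N" "0 < N"
  shows "gap_depth (take p W) < N"
proof (cases "take p W = []")
  case False
  then have "last (take p W) \<in> set W" using in_set_takeD last_in_set by metis
  with False assms show ?thesis by (auto simp: gap_depth_def)
qed (use assms(2) in \<open>simp add: gap_depth_def\<close>)

lemma map_fst_annotate: "map fst (annotate u \<delta>) = u"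
  by (induction u \<delta> rule: annotate.induct) auto

lemma run_fst_ann: "ann_run T G N s W s' \<Longrightarrow> run T s (map fst W) s'"
  unfolding ann_run_def by (induction W arbitrary: s) auto

text \<open>
  In the hair system over \<open>\<Gamma>\<^sub>N\<close> every annotated word with depths below \<open>N\<close> closes at the base
  vertex, hence so does its free reduction, which is also the label of the path from the base
  vertex to the end vertex.
\<close>

lemma amp_stops_if_depths_less:
  assumes reach: "ann_reach (elem_identities X R) (H \<union> winv ` H) W"
    and depth: "\<forall>(a, d)\<in>set W. d < N" and "0 < N"
  shows "amp_stops R H (freduce (map fst W)) N"
proof -
  define w where "w = freduce (map fst W)"
  define \<Gamma> where "\<Gamma> = amp_graph R H w N"
  let ?T = "hair_step (star R) \<Gamma>" and ?G = "good (star R) \<Gamma>" and ?A = "verts (initial_graph H w)"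
  let ?e = "embed R H w 0 N"
  \<comment> \<open>At least one folding has taken place; the initial graph itself need not be
    deterministic.\<close>
  obtain M where M: "N = Suc M" using \<open>0 < N\<close> gr0_implies_Suc by blast
  have "inverse_system (estep \<Gamma>)"
    unfolding \<Gamma>_def M amp_graph.simps by (intro inverse_system_stallings wf_completion wf_amp)
  then have inv: "inverse_system ?T" by (rule inverse_system_hair_step)
  have compl: "complete (star R) \<Gamma> N (?e v)" if "v \<in> ?A" for v
    using complete_embed[of v R H w 0 N] that by (simp add: \<Gamma>_def)
  have free: "complete (star R) \<Gamma> N u \<and> complete (star R) \<Gamma> N v"
    if "(u, x, v) \<in> edges \<Gamma>" "\<not> occurs (star R) x" for u x v
    using free_edges_initial[of u x v R H w N] that compl by (auto simp: \<Gamma>_def occurs_def)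
  have est: "estep \<Gamma> a (?e u) (?e v)" if "estep (initial_graph H w) a u v" for a u v
    by (rule estep_hom[OF _ that]) (use embed_edges[of _ _ _ R H w 0 N] in \<open>simp add: \<Gamma>_def\<close>)
  have start: "?e Base = start \<Gamma>"
    using embed_start[of R H w 0 N] by (simp add: \<Gamma>_def initial_graph_def Let_def)
  let ?s = "(start \<Gamma>, [])"
  have "Base \<in> ?A" using wf_initial[of H w] by (auto simp: wf_graph_def initial_graph_def Let_def)
  then have base: "?G N ?s" using compl[of Base] start by (simp add: good_def)

  \<comment> \<open>Both ends of each step carry the level condition, which makes the step relation
    symmetric under inversion, so that \<open>run_winv\<close> covers the inverses of elements of
    \<open>H\<close>.\<close>
  have H_loop: "run (\<lambda>a x y. ?T a x y \<and> ?G N y \<and> ?G N x) ?s h ?s" if "h \<in> H" for h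
  proof -
    have "run (\<lambda>a x y. letter_edge x a y \<in> arc_edges Base Base h \<and> y \<in> arc_verts Base Base h)
            Base h Base" by (rule run_arc) simp
    then have "run (\<lambda>a x y. estep (initial_graph H w) a x y) Base h Base"
      by (rule run_mono) (use that in \<open>auto simp: estep_def initial_graph_def Let_def\<close>)
    then have "run (\<lambda>a x y. ?T a x y \<and> ?G N y \<and> ?G N x) (?e Base, []) h (?e Base, [])"
    proof (rule run_hom)
      fix a x y assume "estep (initial_graph H w) a x y"
      moreover from estep_verts[OF wf_initial this] compl
      have "complete (star R) \<Gamma> N (?e x)" "complete (star R) \<Gamma> N (?e y)" by blast+
      ultimately show "?T a (?e x, []) (?e y, []) \<and> ?G N (?e y, []) \<and> ?G N (?e x, [])"
        using est hair_step.edge by (fastforce simp: good_def)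
    qed
    with start show ?thesis by simp
  qed
  have J_loop: "run (\<lambda>a x y. ?T a x y \<and> ?G N y) ?s u ?s" if "u \<in> H \<union> winv ` H" for u
  proof -
    have "run (\<lambda>a x y. ?T a x y \<and> ?G N y \<and> ?G N x) ?s u ?s"
    proof (cases "u \<in> H")
      case False
      then obtain h where h: "u = winv h" "h \<in> H" using \<open>u \<in> H \<union> winv ` H\<close> by blast
      show ?thesis
        unfolding h(1) by (subst run_winv) (use inv H_loop[OF h(2)] in \<open>auto simp: inverse_system_def\<close>)
    qed (rule H_loop)
    then show ?thesis by (rule run_mono) blast
  qed
  have I_loop: "run (\<lambda>a x y. ?T a x y \<and> ?G j y) m u m"
    if "u \<in> elem_identities X R" "Suc j \<le> N" "?G (Suc j) m" for u j m
  proof (cases "u \<in> R")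
    case True
    then show ?thesis using good_relator[OF that(3)] star.base by blast
  next
    case False
    then obtain a where u: "u = [a, linv a]"
      using \<open>u \<in> elem_identities X R\<close> unfolding elem_identities_def by blast
    from that(2) have "j \<le> N" by simp
    have "complete (star R) \<Gamma> j u \<and> complete (star R) \<Gamma> j v"
      if "(u, x, v) \<in> edges \<Gamma>" "\<not> occurs (star R) x" for u x v
      using free[OF that] complete_mono[OF \<open>j \<le> N\<close>] by blast
    then show ?thesis unfolding u by (rule good_identity[OF that(3)])
  qed

  have "ann_run ?T ?G N ?s W ?s"
    using reach depth
  proof (induction rule: ann_reach.induct)
    case empty
    then show ?case by (simp add: ann_run_def)
  next
    case (insert W u p)
    then have "\<forall>(a, d)\<in>set W. d < N" using set_ann_insert by blast
    then show ?case
      using insert.IH base gap_depth_less[OF _ \<open>0 < N\<close>] I_loop[OF insert.hyps(2)]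
      by (intro ann_run_insert) auto
  next
    case (append W u)
    then have "\<forall>(a, d)\<in>set W. d < N" by (auto simp: ann_append_def)
    then show ?case using append.IH J_loop[OF append.hyps(2)] by (intro ann_run_append) auto
  qed
  then have loop: "run ?T ?s w ?s"
    unfolding w_def by (intro run_freduce[OF inv] run_fst_ann)

  let ?E = "finish (initial_graph H w)"
  have "run (\<lambda>a x y. letter_edge x a y \<in> arc_edges Base ?E w \<and> y \<in> arc_verts Base ?E w) Base w ?E"
    by (rule run_arc) (simp add: initial_graph_def Let_def)
  then have "run (estep (initial_graph H w)) Base w ?E"
    by (rule run_mono) (auto simp: estep_def initial_graph_def Let_def)
  then have "run ?T (?e Base, []) w (?e ?E, [])"
    by (rule run_hom) (intro hair_step.edge est)
  moreover have "?e ?E = finish \<Gamma>"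
    using embed_finish[of R H w 0 N] by (simp add: \<Gamma>_def)
  ultimately have "run ?T ?s w (finish \<Gamma>, [])" using start by simp
  with loop have "start \<Gamma> = finish \<Gamma>" using run_unique[OF inv] by blast
  then show ?thesis by (simp add: amp_stops_def \<Gamma>_def w_def)
qed

section \<open>Sizes of the graphs and running time\<close>

lemma card_UN_le_sum:
  assumes "finite I" "\<And>i. i \<in> I \<Longrightarrow> card (A i) \<le> f i"
  shows "card (\<Union>i\<in>I. A i) \<le> (\<Sum>i\<in>I. f i)"
  using card_UN_le[OF assms(1), of A] sum_mono[of I "\<lambda>i. card (A i)" f] assms(2) by simp

lemma finite_arc: "finite (arc_verts u v w)" "finite (arc_edges u v w)"
  by (simp_all add: arc_verts_def arc_edges_def setcompr_eq_image)

lemma card_arc_verts: "card (arc_verts u v w) \<le> Suc (length w)"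
  using card_image_le[of "{..length w}" "arc_node u v w"]
  by (simp add: arc_verts_def setcompr_eq_image atMost_def)

lemma card_arc_edges: "card (arc_edges u v w) \<le> length w"
  using card_image_le[of "{..<length w}"
      "\<lambda>j. letter_edge (arc_node u v w j) (w ! j) (arc_node u v w (Suc j))"]
  by (simp add: arc_edges_def setcompr_eq_image lessThan_def)

lemma arc_verts_loop: "arc_verts u u w \<subseteq> insert u (Fresh u u w ` {1..<length w})"
  by (auto simp: arc_verts_def arc_node_def)

lemma finite_completion: "finite S \<Longrightarrow> finite_graph \<Gamma> \<Longrightarrow> finite_graph (completion S \<Gamma>)"
  by (simp add: finite_graph_def completion_def finite_arc)

lemma finite_stallings: "finite_graph \<Gamma> \<Longrightarrow> finite_graph (stallings \<Gamma>)"
  by (simp add: finite_graph_def stallings_def)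

lemma finite_initial: "finite H \<Longrightarrow> finite_graph (initial_graph H w)"
  by (simp add: finite_graph_def initial_graph_def Let_def finite_arc)

lemma finite_amp: "finite R \<Longrightarrow> finite H \<Longrightarrow> finite_graph (amp_graph R H w i)"
  by (induction i) (auto intro: finite_initial finite_stallings finite_completion finite_star)

text \<open>Loops are based at old vertices, so only their interior vertices are new
  (\<open>arc_verts_loop\<close>).\<close>

lemma card_verts_completion:
  assumes "finite S" "finite (verts \<Gamma>)"
  shows "card (verts (completion S \<Gamma>)) \<le> card (verts \<Gamma>) * (1 + (\<Sum>r\<in>S. length r - 1))"
proof -
  let ?B = "\<lambda>v. \<Union>r\<in>S. Fresh (Old v) (Old v) r ` {1..<length r}"
  have B: "card (?B v) \<le> (\<Sum>r\<in>S. length r - 1)" for v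
  proof (rule card_UN_le_sum[OF assms(1)])
    show "card (Fresh (Old v) (Old v) r ` {1..<length r}) \<le> length r - 1" for r
      using card_image_le[of "{1..<length r}" "Fresh (Old v) (Old v) r"] by simp
  qed
  have "verts (completion S \<Gamma>) \<subseteq> Old ` verts \<Gamma> \<union> (\<Union>v\<in>verts \<Gamma>. ?B v)"
  proof
    fix x assume "x \<in> verts (completion S \<Gamma>)"
    then have "x \<in> Old ` verts \<Gamma> \<or> (\<exists>v\<in>verts \<Gamma>. \<exists>r\<in>S. x \<in> arc_verts (Old v) (Old v) r)"
      by (simp only: completion_def xgraph.simps Un_iff UN_iff)
    moreover have "x \<in> ?B v \<or> x = Old v" if "r \<in> S" "x \<in> arc_verts (Old v) (Old v) r" for v r
      using subsetD[OF arc_verts_loop that(2)] that(1) by (simp only: insert_iff UN_iff) blast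
    ultimately show "x \<in> Old ` verts \<Gamma> \<union> (\<Union>v\<in>verts \<Gamma>. ?B v)"
      by (simp only: Un_iff UN_iff) (metis imageI)
  qed
  then have "card (verts (completion S \<Gamma>)) \<le> card (Old ` verts \<Gamma> \<union> (\<Union>v\<in>verts \<Gamma>. ?B v))"
    by (rule card_mono[rotated]) (use assms in auto)
  also have "\<dots> \<le> card (Old ` verts \<Gamma>) + card (\<Union>v\<in>verts \<Gamma>. ?B v)" by (rule card_Un_le)
  also have "\<dots> \<le> card (verts \<Gamma>) + (\<Sum>v\<in>verts \<Gamma>. (\<Sum>r\<in>S. length r - 1))"
    using card_image_le[OF assms(2), of Old] card_UN_le_sum[OF assms(2), of ?B, OF B]
    by (rule add_mono)
  finally show ?thesis by simp
qed

lemma card_edges_completion: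
  assumes "finite S" "finite_graph \<Gamma>"
  shows "card (edges (completion S \<Gamma>)) \<le> card (edges \<Gamma>) + card (verts \<Gamma>) * total_length S"
proof -
  have fin: "finite (verts \<Gamma>)" "finite (edges \<Gamma>)" using assms(2) by (auto simp: finite_graph_def)
  let ?B = "\<lambda>v. \<Union>r\<in>S. arc_edges (Old v) (Old v) r"
  have B: "card (?B v) \<le> total_length S" for v
    unfolding total_length_def by (rule card_UN_le_sum[OF assms(1) card_arc_edges])
  have "card (edges (completion S \<Gamma>))
          \<le> card ((\<lambda>(u, x, v). (Old u, x, Old v)) ` edges \<Gamma>) + card (\<Union>v\<in>verts \<Gamma>. ?B v)"
    unfolding completion_def by (simp add: card_Un_le)
  also have "\<dots> \<le> card (edges \<Gamma>) + (\<Sum>v\<in>verts \<Gamma>. total_length S)"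
    using card_image_le[OF fin(2)] card_UN_le_sum[OF fin(1), of ?B, OF B]
    by (rule add_mono)
  finally show ?thesis by simp
qed

lemma growth_ge_1: "1 \<le> growth R"
  by (simp add: growth_def)

lemma card_verts_stallings: "finite_graph \<Gamma> \<Longrightarrow> card (verts (stallings \<Gamma>)) \<le> card (verts \<Gamma>)"
  by (simp add: stallings_def finite_graph_def card_image_le)

lemma card_edges_stallings: "finite_graph \<Gamma> \<Longrightarrow> card (edges (stallings \<Gamma>)) \<le> card (edges \<Gamma>)"
  by (simp add: stallings_def finite_graph_def card_image_le)

lemma card_verts_amp:
  assumes "finite R" "finite H"
  shows "card (verts (amp_graph R H w i)) \<le> card (verts (initial_graph H w)) * growth R ^ i"
proof (induction i)
  case (Suc i)
  note fin = finite_amp[OF assms, of w i]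
  have "card (verts (amp_graph R H w (Suc i))) \<le> card (verts (amp_graph R H w i)) * growth R"
    unfolding amp_graph.simps growth_def
    using card_verts_stallings[OF finite_completion[OF finite_star[OF assms(1)] fin]]
      card_verts_completion[OF finite_star[OF assms(1)], of "amp_graph R H w i"] fin
    unfolding finite_graph_def by linarith
  also have "\<dots> \<le> card (verts (initial_graph H w)) * growth R ^ i * growth R"
    using Suc by (rule mult_le_mono1)
  finally show ?case by (simp add: ac_simps)
qed simp

text \<open>An iteration adds edges in proportion to the current number of vertices, so up to a
  factor linear in \<open>i\<close> the edges grow at the vertex rate. The base of the exponential
  thus comes from the vertices alone.\<close>

lemma card_edges_amp:
  assumes "finite R" "finite H"
  shows "card (edges (amp_graph R H w i)) \<le>
     card (edges (initial_graph H w)) +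
     i * total_length (star R) * (card (verts (initial_graph H w)) * growth R ^ i)"
proof (induction i)
  case (Suc i)
  let ?\<Gamma> = "amp_graph R H w" and ?l = "total_length (star R)"
  let ?v = "card (verts (initial_graph H w))" and ?e = "card (edges (initial_graph H w))"
  note fin = finite_amp[OF assms, of w i]
  have pow: "growth R ^ i \<le> growth R ^ Suc i"
    using growth_ge_1[of R] by (intro power_increasing) auto
  have "card (edges (?\<Gamma> (Suc i))) \<le> card (edges (completion (star R) (?\<Gamma> i)))"
    using card_edges_stallings[OF finite_completion[OF finite_star[OF assms(1)] fin]] by simp
  also have "\<dots> \<le> card (edges (?\<Gamma> i)) + card (verts (?\<Gamma> i)) * ?l"
    by (rule card_edges_completion[OF finite_star[OF assms(1)] fin])
  also have "\<dots> \<le> (?e + i * ?l * (?v * growth R ^ i)) + (?v * growth R ^ i) * ?l"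
    using Suc card_verts_amp[OF assms] by (intro add_mono mult_le_mono1) auto
  also have "\<dots> = ?e + Suc i * ?l * (?v * growth R ^ i)" by (simp add: algebra_simps)
  also have "\<dots> \<le> ?e + Suc i * ?l * (?v * growth R ^ Suc i)"
    using pow by (intro add_left_mono mult_le_mono) auto
  finally show ?case .
qed simp

lemma size_completion_amp:
  assumes "finite R" "finite H" "i < N"
  shows "size_graph (completion (star R) (amp_graph R H w i))
     \<le> size_graph (initial_graph H w) * (N * total_length (star R) + 1) * growth R ^ N"
proof -
  let ?\<Gamma> = "amp_graph R H w" and ?l = "total_length (star R)" and ?b = "growth R ^ N"
  let ?v = "card (verts (initial_graph H w))" and ?e = "card (edges (initial_graph H w))"
  note fin = finite_amp[OF assms(1,2), of w i]
  have pow: "growth R ^ i \<le> ?b" "growth R ^ Suc i \<le> ?b"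
    using growth_ge_1[of R] assms(3) by (intro power_increasing; simp)+
  have "card (verts (completion (star R) (?\<Gamma> i))) \<le> card (verts (?\<Gamma> i)) * growth R"
    using card_verts_completion[OF finite_star[OF assms(1)]] fin
    by (simp add: finite_graph_def growth_def)
  also have "\<dots> \<le> ?v * growth R ^ i * growth R"
    using card_verts_amp[OF assms(1,2)] by (rule mult_le_mono1)
  also have "\<dots> = ?v * growth R ^ Suc i" by simp
  also have "\<dots> \<le> ?v * ?b" using pow(2) by (rule mult_le_mono2)
  finally have V: "card (verts (completion (star R) (?\<Gamma> i))) \<le> ?v * ?b" .
  have "card (edges (completion (star R) (?\<Gamma> i))) \<le> card (edges (?\<Gamma> i)) + card (verts (?\<Gamma> i)) * ?l"
    by (rule card_edges_completion[OF finite_star[OF assms(1)] fin])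
  also have "\<dots> \<le> (?e + i * ?l * (?v * growth R ^ i)) + (?v * growth R ^ i) * ?l"
    using card_edges_amp[OF assms(1,2)] card_verts_amp[OF assms(1,2)]
    by (intro add_mono mult_le_mono1) auto
  also have "\<dots> = ?e + Suc i * ?l * (?v * growth R ^ i)" by (simp add: algebra_simps)
  also have "\<dots> \<le> ?e * ?b + N * ?l * (?v * ?b)"
    using pow(1) assms(3) growth_ge_1[of R] by (intro add_mono mult_le_mono) auto
  finally have E: "card (edges (completion (star R) (?\<Gamma> i))) \<le> ?e * ?b + N * ?l * (?v * ?b)" .
  have "size_graph (completion (star R) (?\<Gamma> i)) \<le> ?v * ?b + (?e * ?b + N * ?l * (?v * ?b))"
    unfolding size_graph_def using V E by (rule add_mono)
  also have "\<dots> \<le> (?v + ?e) * (N * ?l + 1) * ?b" by (simp add: algebra_simps)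
  finally show ?thesis by (simp add: size_graph_def)
qed

lemma size_initial:
  assumes "finite H"
  shows "size_graph (initial_graph H w) \<le> 2 * length w + 1 + (\<Sum>h\<in>H. 2 * length h + 1)"
proof -
  let ?e = "if w = [] then Base else End"
  have "card (verts (initial_graph H w)) \<le> card (arc_verts Base ?e w) + card (\<Union>h\<in>H. arc_verts Base Base h)"
    unfolding initial_graph_def Let_def by (simp add: card_Un_le)
  also have "\<dots> \<le> Suc (length w) + (\<Sum>h\<in>H. Suc (length h))"
    using card_arc_verts card_UN_le_sum[OF assms card_arc_verts]
    by (rule add_mono)
  finally have V: "card (verts (initial_graph H w)) \<le> Suc (length w) + (\<Sum>h\<in>H. Suc (length h))" .
  have "card (edges (initial_graph H w)) \<le> card (arc_edges Base ?e w) + card (\<Union>h\<in>H. arc_edges Base Base h)"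
    unfolding initial_graph_def Let_def by (simp add: card_Un_le)
  also have "\<dots> \<le> length w + (\<Sum>h\<in>H. length h)"
    using card_arc_edges card_UN_le_sum[OF assms card_arc_edges]
    by (rule add_mono)
  finally have "card (edges (initial_graph H w)) \<le> length w + (\<Sum>h\<in>H. length h)" .
  with V have "size_graph (initial_graph H w)
      \<le> Suc (length w) + (\<Sum>h\<in>H. Suc (length h)) + (length w + (\<Sum>h\<in>H. length h))"
    unfolding size_graph_def by (rule add_mono)
  also have "\<dots> = 2 * length w + 1 + (\<Sum>h\<in>H. 2 * length h + 1)"
    by (simp add: sum.distrib sum_Suc mult_2)
  finally show ?thesis .
qed

section \<open>Running time bounds valid at all sizes\<close>

definition quasilinear :: "real \<Rightarrow> nat \<Rightarrow> real \<Rightarrow> real" where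
  "quasilinear C k s = C * (s + 1) * ln (s + 3) ^ k"

text \<open>The shift by 3 suffices because \<open>exp 1 \<le> 3\<close>. Powers of a logarithm that
  is at least 1 increase with the exponent, which makes \<open>quasilinear\<close> monotone in
  \<open>k\<close> as well.\<close>

lemma ln_add_3_ge_1: "1 \<le> ln (s + 3)" if "0 \<le> s" for s :: real
proof -
  have "exp 1 \<le> s + 3" using exp_le that by linarith
  then show ?thesis using that by (simp add: ln_ge_iff)
qed

lemma quasilinear_mono:
  assumes "0 \<le> C" "C \<le> C'" "k \<le> k'" "0 \<le> s" "s \<le> s'"
  shows "quasilinear C k s \<le> quasilinear C' k' s'"
proof -
  have "ln (s + 3) ^ k \<le> ln (s' + 3) ^ k'"
  proof -
    have "ln (s + 3) ^ k \<le> ln (s' + 3) ^ k"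
      using assms ln_add_3_ge_1[of s] by (intro power_mono) auto
    also have "\<dots> \<le> ln (s' + 3) ^ k'"
      using assms ln_add_3_ge_1[of s'] by (intro power_increasing) auto
    finally show ?thesis .
  qed
  then show ?thesis
    unfolding quasilinear_def using assms ln_add_3_ge_1[of s] by (intro mult_mono) auto
qed

lemma nearly_linear_quasilinear:
  assumes "nearly_linear t"
  obtains C k where "0 \<le> C" "\<And>\<Gamma>. finite_graph \<Gamma> \<Longrightarrow> real (t \<Gamma>) \<le> quasilinear C k (real (size_graph \<Gamma>))"
proof -
  from assms obtain f k where f: "f \<in> O(\<lambda>n. real n powr 1 * ln (real n) ^ k)"
    and t: "\<And>\<Gamma>. finite_graph \<Gamma> \<Longrightarrow> real (t \<Gamma>) \<le> f (size_graph \<Gamma>)"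
    unfolding nearly_linear_def soft_O_def by blast
  from f obtain c where "c > 0"
    and "eventually (\<lambda>n. norm (f n) \<le> c * norm (real n powr 1 * ln (real n) ^ k)) at_top"
    by (auto elim: landau_o.bigE)
  then obtain n0 where n0: "\<And>n. n \<ge> n0 \<Longrightarrow> norm (f n) \<le> c * norm (real n powr 1 * ln (real n) ^ k)"
    by (auto simp: eventually_at_top_linorder)
  \<comment> \<open>The sum absorbs the finitely many sizes at which the asymptotic bound may
    fail.\<close>
  define C where "C = c + (\<Sum>n<n0. \<bar>f n\<bar>)"
  have C: "c \<le> C" "\<And>n. n < n0 \<Longrightarrow> \<bar>f n\<bar> \<le> C" "0 \<le> C"
  proof -
    show "c \<le> C" by (simp add: C_def sum_nonneg)
    show "\<bar>f n\<bar> \<le> C" if "n < n0" for n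
      using member_le_sum[of n "{..<n0}" "\<lambda>n. \<bar>f n\<bar>"] that \<open>c > 0\<close> by (simp add: C_def)
    show "0 \<le> C" using \<open>c > 0\<close> by (simp add: C_def sum_nonneg)
  qed
  have "f n \<le> quasilinear C k (real n)" for n
  proof (cases "n < n0")
    case True
    have "1 * 1 \<le> (real n + 1) * ln (real n + 3) ^ k"
      using ln_add_3_ge_1[of "real n"] by (intro mult_mono one_le_power) auto
    then have "C \<le> quasilinear C k (real n)"
      using C(3) mult_left_mono[of 1 "(real n + 1) * ln (real n + 3) ^ k" C]
      by (simp add: quasilinear_def mult.assoc)
    with C(2)[OF True] show ?thesis by simp
  next
    case False
    show ?thesis
    proof (cases "n = 0")
      case True
      \<comment> \<open>At size 0 the bound contains \<open>0 powr 1 = 0\<close> and leaves no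
        positive value.\<close>
      have "f n \<le> 0" using n0[of n] False True by simp
      also have "0 \<le> quasilinear C k (real n)"
        using C(3) ln_add_3_ge_1[of "real n"] by (simp add: quasilinear_def)
      finally show ?thesis .
    next
      case npos: False
      have "f n \<le> c * (real n * ln (real n) ^ k)"
        using n0[of n] False npos by simp
      also have "\<dots> \<le> C * ((real n + 1) * ln (real n + 3) ^ k)"
        using C npos by (intro mult_mono power_mono) auto
      finally show ?thesis by (simp add: quasilinear_def mult.assoc)
    qed
  qed
  with t C(3) that show ?thesis by (meson order_trans)
qed

text \<open>\<open>S\<close> bounds the size of every graph written or folded. At most
  \<open>N\<close> iterations cost one writing and one folding each, and the initial graph costs one
  more writing, which gives the factor \<open>2 * real N + 1\<close>; the added 1 pays for the
  tests.\<close>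

lemma amp_time_bound:
  assumes "finite R" "finite H" "nearly_linear write_time" "nearly_linear fold_time"
  obtains C k where "0 \<le> C"
    "\<And>w N S. amp_stops R H w N \<Longrightarrow>
       real (size_graph (initial_graph H w)) * (real N * real (total_length (star R)) + 1) * real (growth R) ^ N \<le> S \<Longrightarrow>
       ereal_of_enat (amp_time write_time fold_time R H w)
         \<le> ereal ((2 * real N + 1) * (quasilinear C k S + 1))"
proof -
  obtain C1 k1 where 1: "0 \<le> C1"
    "\<And>\<Gamma>. finite_graph \<Gamma> \<Longrightarrow> real (write_time \<Gamma>) \<le> quasilinear C1 k1 (real (size_graph \<Gamma>))"
    using nearly_linear_quasilinear[OF assms(3)] by blast
  obtain C2 k2 where 2: "0 \<le> C2"
    "\<And>\<Gamma>. finite_graph \<Gamma> \<Longrightarrow> real (fold_time \<Gamma>) \<le> quasilinear C2 k2 (real (size_graph \<Gamma>))"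
    using nearly_linear_quasilinear[OF assms(4)] by blast
  let ?q = "quasilinear (max C1 C2) (max k1 k2)"
  have t: "real (write_time \<Gamma>) \<le> ?q S" "real (fold_time \<Gamma>) \<le> ?q S"
    if "finite_graph \<Gamma>" "real (size_graph \<Gamma>) \<le> S" for \<Gamma> S
    using 1(2)[OF that(1)] 2(2)[OF that(1)]
      quasilinear_mono[OF 1(1), of "max C1 C2" k1 "max k1 k2", OF _ _ _ that(2)]
      quasilinear_mono[OF 2(1), of "max C1 C2" k2 "max k1 k2", OF _ _ _ that(2)] by simp_all
  show ?thesis
  proof (rule that[of "max C1 C2" "max k1 k2"])
    show "0 \<le> max C1 C2" using 1(1) by simp
    fix w N S assume stop: "amp_stops R H w N"
      and S: "real (size_graph (initial_graph H w)) * (real N * real (total_length (star R)) + 1) * real (growth R) ^ N \<le> S"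
    let ?\<Gamma> = "amp_graph R H w" and ?\<Delta> = "\<lambda>i. completion (star R) (amp_graph R H w i)"
    let ?M = "amp_iterations R H w"
    have M: "?M \<le> N" unfolding amp_iterations_def using stop by (rule Least_le)
    have szi: "real (size_graph (initial_graph H w)) \<le> S"
    proof -
      have "1 * 1 \<le> (real N * real (total_length (star R)) + 1) * real (growth R) ^ N"
        using growth_ge_1[of R] by (intro mult_mono one_le_power) auto
      then have "real (size_graph (initial_graph H w)) * 1 \<le> real (size_graph (initial_graph H w)) *
          ((real N * real (total_length (star R)) + 1) * real (growth R) ^ N)"
        by (intro mult_left_mono) auto
      with S show ?thesis by (simp add: mult.assoc)
    qed
    have szc: "real (size_graph (?\<Delta> i)) \<le> S" if "i < ?M" for i
    proof -
      have "real (size_graph (?\<Delta> i)) \<le> real (size_graph (initial_graph H w) * (N * total_length (star R) + 1) * growth R ^ N)"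
        using size_completion_amp[OF assms(1,2), of i N w] that M by (simp del: of_nat_mult)
      also have "\<dots> \<le> S" using S by (simp add: algebra_simps)
      finally show ?thesis .
    qed
    have q0: "0 \<le> ?q S"
      using order_trans[OF _ t(1)[OF finite_initial[OF assms(2)] szi]] by simp
    have "real (\<Sum>i<?M. write_time (?\<Delta> i) + fold_time (?\<Delta> i) + 1) \<le> (\<Sum>i<?M. 2 * ?q S + 1)"
      unfolding of_nat_sum
    proof (rule sum_mono)
      fix i assume "i \<in> {..<?M}"
      then have "i < ?M" by simp
      from t[OF finite_completion[OF finite_star[OF assms(1)] finite_amp[OF assms(1,2)]] szc[OF this]]
      show "real (write_time (?\<Delta> i) + fold_time (?\<Delta> i) + 1) \<le> 2 * ?q S + 1" by simp
    qed
    also have "\<dots> = real ?M * (2 * ?q S + 1)" by simp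
    also have "\<dots> \<le> real N * (2 * ?q S + 2)"
      using M q0 by (intro mult_mono) auto
    finally have "real (write_time (initial_graph H w) + 1 +
        (\<Sum>i<?M. write_time (?\<Delta> i) + fold_time (?\<Delta> i) + 1)) \<le> (2 * real N + 1) * (?q S + 1)"
      using t(1)[OF finite_initial[OF assms(2)] szi] by (simp add: algebra_simps)
    then show "ereal_of_enat (amp_time write_time fold_time R H w) \<le> ereal ((2 * real N + 1) * (?q S + 1))"
      using stop unfolding amp_time_def Let_def by auto
  qed
qed

text \<open>Squaring avoids the half-integer exponent. For \<open>L \<ge> 4\<close> the square of
  \<open>1 + 2 * (L * (L - 1))\<close> is at most \<open>4 * L ^ 4\<close>, hence at most
  \<open>L ^ 5\<close>; for 1, 2, 3 it is 1, 25, 169 against 1, 32, 243.\<close>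

lemma ln_growth_le:
  assumes "finite R" "1 \<le> total_length R"
  shows "ln (real (growth R)) \<le> 5 / 2 * ln (real (total_length R))"
proof -
  let ?L = "total_length R" and ?b = "growth R"
  have "(1 + 2 * (?L * (?L - 1))) ^ 2 \<le> ?L ^ 5"
  proof (cases "?L \<le> 3")
    case True
    with assms(2) consider "?L = 1" | "?L = 2" | "?L = 3" by linarith
    then show ?thesis by cases auto
  next
    case False
    then have "1 + 2 * (?L * (?L - 1)) \<le> 2 * ?L ^ 2"
      by (cases ?L) (auto simp: power2_eq_square)
    then have "(1 + 2 * (?L * (?L - 1))) ^ 2 \<le> (2 * ?L ^ 2) ^ 2" by (rule power_mono) simp
    also have "\<dots> = 4 * ?L ^ 4" by (simp add: power_mult_distrib)
    also have "\<dots> \<le> ?L * ?L ^ 4" using False by (intro mult_le_mono1) simp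
    finally show ?thesis by (simp add: power_numeral_reduce)
  qed
  moreover have "?b ^ 2 \<le> (1 + 2 * (?L * (?L - 1))) ^ 2"
    using growth_le[OF assms(1)] by (rule power_mono) simp
  ultimately have "?b ^ 2 \<le> ?L ^ 5" by linarith
  then have "real ?b ^ 2 \<le> real ?L ^ 5" by (simp flip: of_nat_power)
  then have "ln (real ?b ^ 2) \<le> ln (real ?L ^ 5)"
    using growth_ge_1[of R] assms(2) by (subst ln_le_cancel_iff) auto
  then show ?thesis using growth_ge_1[of R] assms(2) by (simp add: ln_realpow)
qed

text \<open>For total length 0 the convention \<open>ln 0 = 0\<close> makes the exponent of the time
  bound 1, which is correct because the graphs then gain no vertices.\<close>

lemma growth_trivial:
  assumes "finite R" "total_length R = 0"
  shows "growth R = 1"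
  using growth_le[OF assms(1)] growth_ge_1[of R] assms(2) by simp

section \<open>The generated words lie in the subgroup\<close>

lemma inv_free_group: "inv\<^bsub>free_group X\<^esub> w = winv w" if "w \<in> carrier (free_group X)"
proof (rule group.inv_equality[OF group_free_group])
  show "winv w \<otimes>\<^bsub>free_group X\<^esub> w = \<one>\<^bsub>free_group X\<^esub>"
    by (simp add: free_group_def freduce_winv_append)
  show "winv w \<in> carrier (free_group X)"
    using that by (auto simp: free_group_def reduced_winv set_winv linv_def)
qed (rule that)

lemma freduce_carrier: "set w \<subseteq> X \<times> UNIV \<Longrightarrow> freduce w \<in> carrier (free_group X)"
  using set_freduce[of w] by (auto simp: free_group_def)

lemma freduce_append_mult: "freduce (u @ v) = freduce u \<otimes>\<^bsub>free_group X\<^esub> freduce v"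
  by (simp add: free_group_def freduce_append_left freduce_append_right)

lemma freduce_identity: "freduce [a, linv a] = []"
  by (simp add: freduce_def linv_eq_iff)

context
  fixes X :: "'a set" and R :: "'a gword set"
  assumes R: "R \<subseteq> carrier (free_group X)"
begin

lemma pres_hom: "group_hom (free_group X) (presented_group X R) (pres_class X R)"
proof -
  interpret normal "normal_closure X R" "free_group X" by (rule normal_normal_closure[OF R])
  have "pres_class X R = (\<lambda>a. normal_closure X R #>\<^bsub>free_group X\<^esub> a)"
    by (simp add: pres_class_def fun_eq_iff)
  then show ?thesis
    using r_coset_hom_Mod factorgroup_is_group group_free_group
    by (simp add: group_hom_def group_hom_axioms_def presented_group_def)
qed

lemma pres_class_relator:
  assumes "r \<in> R"
  shows "pres_class X R r = \<one>\<^bsub>presented_group X R\<^esub>"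
proof -
  interpret normal "normal_closure X R" "free_group X" by (rule normal_normal_closure[OF R])
  have "r = \<one>\<^bsub>free_group X\<^esub> \<otimes>\<^bsub>free_group X\<^esub> r \<otimes>\<^bsub>free_group X\<^esub> inv\<^bsub>free_group X\<^esub> \<one>\<^bsub>free_group X\<^esub>"
    using assms R by (simp add: subsetD)
  then have "r \<in> normal_closure X R"
    unfolding normal_closure_def using assms one_closed by (intro generate.incl) blast
  then show ?thesis
    by (simp add: pres_class_def presented_group_def rcos_const)
qed

text \<open>Inserted words are trivial in the presented group, so an insertion keeps the class of
  the word; an appended factor multiplies it by a generator of the subgroup or by the inverse of
  one.\<close>

lemma reach_in_MSP:
  assumes "H \<subseteq> carrier (free_group X)"
    and "ann_reach (elem_identities X R) (H \<union> winv ` H) W"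
  shows "freduce (map fst W) \<in> MSP X R H"
proof -
  interpret group_hom "free_group X" "presented_group X R" "pres_class X R" by (rule pres_hom)
  let ?\<phi> = "\<lambda>w. pres_class X R (freduce w)"
  let ?K = "generate (presented_group X R) (pres_class X R ` H)"
  have "\<one>\<^bsub>free_group X\<^esub> = []" by (simp add: free_group_def)
  then have class_one: "pres_class X R [] = \<one>\<^bsub>presented_group X R\<^esub>" using hom_one by metis
  have hom: "?\<phi> (u @ v) = ?\<phi> u \<otimes>\<^bsub>presented_group X R\<^esub> ?\<phi> v"
    if "set u \<subseteq> X \<times> UNIV" "set v \<subseteq> X \<times> UNIV" for u v
    using that by (simp add: freduce_append_mult[where X = X] freduce_carrier)
  have cl: "?\<phi> u \<in> carrier (presented_group X R)" if "set u \<subseteq> X \<times> UNIV" for u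
    using that by (simp add: freduce_carrier)
  have red: "freduce u = u" "set u \<subseteq> X \<times> UNIV" if "u \<in> carrier (free_group X)" for u
    using that by (simp_all add: free_group_def freduce_reduced)
  have "set (map fst W) \<subseteq> X \<times> UNIV \<and> ?\<phi> (map fst W) \<in> ?K"
    using assms(2)
  proof (induction rule: ann_reach.induct)
    case empty
    have "?\<phi> [] = \<one>\<^bsub>presented_group X R\<^esub>" using class_one by (simp add: freduce_def)
    then show ?case by (simp add: generate.one)
  next
    case (insert W u p)
    let ?s = "map fst (take p W)" and ?t = "map fst (drop p W)"
    have W: "map fst W = ?s @ ?t" by (simp flip: map_append)
    have st: "set ?s \<subseteq> X \<times> UNIV" "set ?t \<subseteq> X \<times> UNIV" using insert.IH W by auto
    have u: "set u \<subseteq> X \<times> UNIV \<and> ?\<phi> u = \<one>\<^bsub>presented_group X R\<^esub>"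
    proof (cases "u \<in> R")
      case True
      then show ?thesis using red[of u] R pres_class_relator[OF True] by auto
    next
      case False
      then obtain a where "a \<in> X \<times> UNIV" "u = [a, linv a]"
        using insert.hyps(2) unfolding elem_identities_def by blast
      moreover from this have "set u \<subseteq> X \<times> UNIV" by (cases a) (simp add: linv_def)
      ultimately show ?thesis using class_one by (simp only: freduce_identity simp_thms)
    qed
    have "?\<phi> (?s @ u @ ?t) = ?\<phi> (map fst W)"
      using st u cl[OF st(1)] cl[OF st(2)] unfolding W by (simp add: hom)
    with insert.IH st u show ?case
      by (auto simp: ann_insert_def map_fst_annotate)
  next
    case (append W u)
    obtain h where h: "h \<in> H" "u = h \<or> u = winv h" using append.hyps(2) by blast
    have hc: "h \<in> carrier (free_group X)" using h(1) assms(1) by blast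
    then have "winv h \<in> carrier (free_group X)"
      using inv_free_group G.inv_closed by metis
    then have uc: "u \<in> carrier (free_group X)" using h hc by blast
    have "pres_class X R u \<in> ?K"
    proof (cases "u = h")
      case True
      then show ?thesis using h(1) by (simp add: generate.incl)
    next
      case False
      then have "pres_class X R u = inv\<^bsub>presented_group X R\<^esub> pres_class X R h"
        using h(2) hom_inv[OF hc] inv_free_group[OF hc] by simp
      then show ?thesis using h(1) by (simp add: generate.inv)
    qed
    then have "?\<phi> (map fst W @ u) \<in> ?K"
      using append.IH red[OF uc] by (simp add: hom generate.eng)
    then show ?case using append.IH red[OF uc] by (auto simp: ann_append_def comp_def)
  qed
  then show ?thesis by (simp add: MSP_def freduce_carrier)
qed

end

section \<open>The depth of a random word\<close>

text \<open>A coupling of the generator with depths: the same random choices are made on annotated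
  words, and forgetting the annotation recovers the generator (\<open>map_ann_word\<close>).\<close>

definition ann_transformation :: "'a gword pmf \<Rightarrow> 'a annotated \<Rightarrow> 'a annotated pmf" where
  "ann_transformation PI W = do {
     u \<leftarrow> PI;
     p \<leftarrow> pmf_of_set {0..length W};
     return_pmf (ann_insert W u p)
   }"

definition ann_step ::
  "'a gword set \<Rightarrow> real \<Rightarrow> 'a gword pmf \<Rightarrow> 'a gword pmf \<Rightarrow> 'a annotated \<Rightarrow> 'a annotated pmf" where
  "ann_step H q PI PH W =
     (if H = {} then ann_transformation PI W
      else do {
        b \<leftarrow> bernoulli_pmf q;
        if b then map_pmf (ann_append W) PH else ann_transformation PI W
      })"

primrec ann_word ::
  "'a gword set \<Rightarrow> real \<Rightarrow> 'a gword pmf \<Rightarrow> 'a gword pmf \<Rightarrow> nat \<Rightarrow> 'a annotated pmf" where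
  "ann_word H q PI PH 0 = return_pmf []"
| "ann_word H q PI PH (Suc i) = ann_word H q PI PH i \<bind> ann_step H q PI PH"

lemma map_fst_ann_insert: "map fst (ann_insert W u p) = take p (map fst W) @ u @ drop p (map fst W)"
  by (simp add: ann_insert_def map_fst_annotate take_map drop_map)

lemma map_fst_ann_append: "map fst (ann_append W u) = map fst W @ u"
  by (simp add: ann_append_def comp_def)

lemma map_ann_transformation:
  "map_pmf (map fst) (ann_transformation PI W) = rand_transformation PI (map fst W)"
  by (simp add: ann_transformation_def rand_transformation_def map_bind_pmf map_fst_ann_insert)

lemma map_ann_step: "map_pmf (map fst) (ann_step H q PI PH W) = rsw2_step H q PI PH (map fst W)"
proof -
  have "map_pmf (map fst) (if b then map_pmf (ann_append W) PH else ann_transformation PI W) =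
      (if b then map_pmf (\<lambda>u. map fst W @ u) PH else rand_transformation PI (map fst W))" for b
    by (cases b) (auto simp: map_ann_transformation pmf.map_comp comp_def map_fst_ann_append)
  then show ?thesis
    by (simp add: ann_step_def rsw2_step_def map_bind_pmf map_ann_transformation)
qed

lemma map_ann_word: "map_pmf (map fst) (ann_word H q PI PH n) = rsw2_word H q PI PH n"
proof (induction n)
  case (Suc n)
  show ?case
    by (simp add: map_bind_pmf map_ann_step bind_map_pmf flip: Suc)
qed simp

lemma length_annotate [simp]: "length (annotate u \<delta>) = length u"
  by (induction u \<delta> rule: annotate.induct) auto

lemma length_ann_insert [simp]: "length (ann_insert W u p) = length W + length u"
  by (simp add: ann_insert_def)

lemma length_ann_append [simp]: "length (ann_append W u) = length W + length u"
  by (simp add: ann_append_def)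

lemma ann_word_reach:
  assumes "set_pmf PI \<subseteq> I" "H \<noteq> {} \<Longrightarrow> set_pmf PH \<subseteq> J" "\<And>u. u \<in> I \<union> J \<Longrightarrow> length u \<le> K"
    and "W \<in> set_pmf (ann_word H q PI PH n)"
  shows "ann_reach I J W \<and> length W \<le> K * n"
  using assms(4)
proof (induction n arbitrary: W)
  case 0
  then show ?case by (simp add: ann_reach.empty)
next
  case (Suc n)
  then obtain V where V: "V \<in> set_pmf (ann_word H q PI PH n)" "W \<in> set_pmf (ann_step H q PI PH V)"
    by auto
  from Suc.IH[OF V(1)] have IH: "ann_reach I J V" "length V \<le> K * n" by auto
  from V(2) have "(\<exists>u p. u \<in> set_pmf PI \<and> W = ann_insert V u p) \<or>
      (\<exists>u. H \<noteq> {} \<and> u \<in> set_pmf PH \<and> W = ann_append V u)"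
    by (auto simp: ann_step_def ann_transformation_def split: if_splits)
  then consider u p where "u \<in> I" "W = ann_insert V u p" | u where "u \<in> J" "W = ann_append V u"
    using assms(1,2) by blast
  then show ?case
  proof cases
    case (1 u p)
    with IH assms(3)[of u] show ?thesis by (auto intro: ann_reach.insert)
  next
    case (2 u)
    with IH assms(3)[of u] show ?thesis by (auto intro: ann_reach.append)
  qed
qed

section \<open>Exponential moment of the depth\<close>

abbreviation (input) e :: real where "e \<equiv> exp 1"

text \<open>The summand 1 is the leftmost gap, of depth 0. A base \<open>z\<close> in place of
  \<open>e\<close> would lead to a depth of about \<open>(z / ln z) * ln n\<close>, which is least
  for \<open>z = e\<close>.\<close>

definition depth_weight :: "'a annotated \<Rightarrow> real" where
  "depth_weight W = 1 + (\<Sum>(a, d)\<leftarrow>W. e ^ d)"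

text \<open>
  Inserting a word of length \<open>k\<close> into a word with \<open>M\<close> gaps multiplies the expected weight by at
  most \<open>1 + e k / M \<le> ((M + k) / M) powr e\<close>. Hence the normalized weight is a supermartingale,
  whatever the lengths of the inserted words are.
\<close>

definition normalized_weight :: "'a annotated \<Rightarrow> real" where
  "normalized_weight W = depth_weight W / (real (length W) + 1) powr e"

lemma e_ge_1: "1 \<le> e"
  by simp

lemma depth_weight_Cons: "depth_weight (c # W) = e ^ snd c + depth_weight W"
  by (simp add: depth_weight_def case_prod_beta)

lemma depth_weight_ge: "real (length W) + 1 \<le> depth_weight W"
proof (induction W)
  case (Cons c W)
  have "1 \<le> e ^ snd c" by (rule one_le_power) simp
  moreover have "real (length (c # W)) = real (length W) + 1" by simp
  ultimately show ?case using Cons unfolding depth_weight_Cons by linarith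
qed (simp add: depth_weight_def)

lemma power_depth_le_weight: "(a, d) \<in> set W \<Longrightarrow> e ^ d \<le> depth_weight W"
proof (induction W)
  case (Cons c W)
  have "0 \<le> depth_weight W" using depth_weight_ge[of W] by simp
  moreover have "0 \<le> e ^ snd c" by simp
  ultimately show ?case
    using Cons unfolding depth_weight_Cons by (cases "c = (a, d)") (auto intro: add_increasing)
qed simp

text \<open>The positions for an insertion are exactly the gaps, so a uniform position sees the mean
  weight per gap. This makes the expected increase at most proportional to the present
  weight.\<close>

lemma sum_power_gap_depth: "(\<Sum>p\<in>{0..length W}. e ^ gap_depth (take p W)) = depth_weight W"
proof -
  have "{0..length W} = {..<Suc (length W)}" by auto
  then have "(\<Sum>p\<in>{0..length W}. e ^ gap_depth (take p W))
      = e ^ gap_depth (take 0 W) + (\<Sum>p\<in>{0..<length W}. e ^ gap_depth (take (Suc p) W))"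
    by (simp only: sum.lessThan_Suc_shift) (simp only: lessThan_atLeast0)
  also have "(\<Sum>p\<in>{0..<length W}. e ^ gap_depth (take (Suc p) W)) = (\<Sum>p\<in>{0..<length W}. e ^ snd (W ! p))"
    by (intro sum.cong) (auto simp: gap_depth_def take_Suc_conv_app_nth)
  also have "\<dots> = (\<Sum>(a, d)\<leftarrow>W. e ^ d)"
    by (simp add: sum_list_sum_nth case_prod_beta)
  finally show ?thesis by (simp add: depth_weight_def gap_depth_def)
qed

lemma sum_annotate_le: "(\<Sum>(a, d)\<leftarrow>annotate u \<delta>. e ^ d) \<le> e * real (length u) * e ^ \<delta>"
  by (induction u \<delta> rule: annotate.induct) (auto simp: algebra_simps)

lemma depth_weight_insert:
  "depth_weight (ann_insert W u p) \<le> depth_weight W + e * real (length u) * e ^ gap_depth (take p W)"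
proof -
  let ?f = "\<lambda>W. \<Sum>(a, d)\<leftarrow>W. e ^ d"
  have "?f (take p W) + ?f (drop p W) = ?f W"
    by (simp only: append_take_drop_id flip: sum_list_append map_append)
  then show ?thesis
    using sum_annotate_le[of u "gap_depth (take p W)"]
    by (simp add: depth_weight_def ann_insert_def)
qed

lemma depth_weight_append: "depth_weight (ann_append W u) = depth_weight W + real (length u)"
  by (simp add: depth_weight_def ann_append_def comp_def sum_list_triv)

text \<open>The convex function \<open>x powr z\<close> lies above its tangent at 1, whose slope is
  \<open>z\<close>.\<close>

lemma Bernoulli_powr:
  fixes x z :: real
  assumes "0 \<le> x" "1 \<le> z"
  shows "1 + z * x \<le> (1 + x) powr z"
proof -
  have "((\<lambda>x. x powr z) has_real_derivative z * 1 powr (z - 1)) (at 1 within {0<..})"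
    by (rule has_field_derivative_at_within) (auto intro!: derivative_eq_intros)
  then have "z * 1 powr (z - 1) * (1 + x - 1) \<le> (1 + x) powr z - 1 powr z"
    using assms by (intro convex_on_imp_above_tangent[OF powr_convex]) (auto simp: interior_open)
  then show ?thesis by simp
qed

lemma weight_growth:
  assumes "0 < M" "0 \<le> k" "0 \<le> y"
  shows "y * (1 + e * (k / M)) / (M + k) powr e \<le> y / M powr e"
proof -
  have "1 + e * (k / M) \<le> (1 + k / M) powr e" using assms by (intro Bernoulli_powr) auto
  also have "1 + k / M = (M + k) / M" using assms by (simp add: field_simps)
  also have "((M + k) / M) powr e = (M + k) powr e / M powr e"
    by (rule powr_divide)
  finally have "y * (1 + e * (k / M)) \<le> y * ((M + k) powr e / M powr e)"
    using assms(3) by (rule mult_left_mono)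
  moreover have "0 < (M + k) powr e" using assms by simp
  ultimately show ?thesis by (simp add: field_simps)
qed

lemma normalized_weight_insert:
  "(\<Sum>p\<in>{0..length W}. normalized_weight (ann_insert W u p)) \<le> (real (length W) + 1) * normalized_weight W"
proof -
  let ?M = "real (length W) + 1" and ?k = "real (length u)" and ?w = "depth_weight W"
  have "(\<Sum>p\<in>{0..length W}. normalized_weight (ann_insert W u p))
      \<le> (\<Sum>p\<in>{0..length W}. (?w + e * ?k * e ^ gap_depth (take p W)) / (?M + ?k) powr e)"
    unfolding normalized_weight_def using depth_weight_insert[of W u]
    by (intro sum_mono divide_right_mono) (auto simp: add_ac intro!: divide_right_mono)
  also have "\<dots> = (?M * ?w + e * ?k * ?w) / (?M + ?k) powr e"
    by (simp add: sum.distrib sum_power_gap_depth flip: sum_divide_distrib sum_distrib_left)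
  also have "?M * ?w + e * ?k * ?w = ?M * (?w * (1 + e * (?k / ?M)))"
    by (simp add: field_simps)
  also have "\<dots> / (?M + ?k) powr e = ?M * (?w * (1 + e * (?k / ?M)) / (?M + ?k) powr e)" by simp
  also have "\<dots> \<le> ?M * (?w / ?M powr e)"
    using depth_weight_ge[of W] by (intro mult_left_mono weight_growth) auto
  finally show ?thesis by (simp add: normalized_weight_def)
qed

text \<open>An appended letter adds weight 1. Since no gap weighs less than 1, this stays below the
  bound for the mean increase under an insertion, and \<open>weight_growth\<close> applies
  again.\<close>

lemma normalized_weight_append: "normalized_weight (ann_append W u) \<le> normalized_weight W"
proof -
  let ?M = "real (length W) + 1" and ?k = "real (length u)" and ?w = "depth_weight W"
  have "?M \<le> ?w" by (rule depth_weight_ge)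
  then have "?k * ?M \<le> ?k * ?w" by (rule mult_left_mono) simp
  also have "\<dots> \<le> e * (?k * ?w)" 
    using mult_right_mono[OF e_ge_1, of "?k * ?w"] \<open>?M \<le> ?w\<close> by simp
  finally have "?w + ?k \<le> ?w * (1 + e * (?k / ?M))" by (simp add: field_simps)
  then have "normalized_weight (ann_append W u) \<le> ?w * (1 + e * (?k / ?M)) / (?M + ?k) powr e"
    unfolding normalized_weight_def depth_weight_append by (auto simp: add_ac intro!: divide_right_mono)
  also have "\<dots> \<le> ?w / ?M powr e"
    using depth_weight_ge[of W] by (intro weight_growth) auto
  finally show ?thesis by (simp add: normalized_weight_def)
qed

lemma normalized_weight_nonneg: "0 \<le> normalized_weight W"
  using depth_weight_ge[of W] by (simp add: normalized_weight_def)

lemma nn_integral_le_const_pmf: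
  assumes "\<And>x. f x \<le> c"
  shows "(\<integral>\<^sup>+x. f x \<partial>measure_pmf p) \<le> c"
  using nn_integral_mono[of "measure_pmf p" f "\<lambda>_. c"] assms by simp

lemma nn_integral_ann_transformation:
  "(\<integral>\<^sup>+V. ennreal (normalized_weight V) \<partial>ann_transformation PI W) \<le> ennreal (normalized_weight W)"
proof -
  have "(\<Sum>p\<in>{0..length W}. ennreal (normalized_weight (ann_insert W u p))) / ennreal (real (length W) + 1)
      \<le> ennreal (normalized_weight W)" for u
  proof -
    have "(\<Sum>p\<in>{0..length W}. ennreal (normalized_weight (ann_insert W u p))) / ennreal (real (length W) + 1)
      = ennreal ((\<Sum>p\<in>{0..length W}. normalized_weight (ann_insert W u p)) / (real (length W) + 1))"
      by (subst sum_ennreal) (auto intro!: divide_ennreal sum_nonneg simp: normalized_weight_nonneg simp del: ennreal_plus)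
    also have "\<dots> \<le> ennreal (normalized_weight W)"
      using normalized_weight_insert[of W u] by (intro ennreal_leI) (simp add: field_simps)
    finally show ?thesis .
  qed
  then show ?thesis
    unfolding ann_transformation_def
    by (simp add: nn_integral_pmf_of_set) (intro nn_integral_le_const_pmf; simp add: add_ac ennreal_of_nat_eq_real_of_nat)
qed

lemma nn_integral_ann_step:
  "(\<integral>\<^sup>+V. ennreal (normalized_weight V) \<partial>ann_step H q PI PH W) \<le> ennreal (normalized_weight W)"
proof (cases "H = {}")
  case True
  then show ?thesis by (simp add: ann_step_def nn_integral_ann_transformation)
next
  case False
  have "(\<integral>\<^sup>+V. ennreal (normalized_weight V) \<partial>(if b then map_pmf (ann_append W) PH else ann_transformation PI W))
      \<le> ennreal (normalized_weight W)" for b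
    by (auto intro!: nn_integral_ann_transformation nn_integral_le_const_pmf ennreal_leI normalized_weight_append)
  with False show ?thesis
    unfolding ann_step_def by (simp del: nn_integral_bernoulli_pmf add: nn_integral_le_const_pmf)
qed

lemma nn_integral_ann_word:
  "(\<integral>\<^sup>+V. ennreal (normalized_weight V) \<partial>ann_word H q PI PH n) \<le> 1"
proof (induction n)
  case 0
  show ?case by (simp add: normalized_weight_def depth_weight_def)
next
  case (Suc n)
  have "(\<integral>\<^sup>+V. ennreal (normalized_weight V) \<partial>ann_word H q PI PH (Suc n))
      \<le> (\<integral>\<^sup>+W. ennreal (normalized_weight W) \<partial>ann_word H q PI PH n)"
    by (simp add: nn_integral_mono nn_integral_ann_step)
  with Suc show ?case by (rule order_trans[rotated])
qed

text \<open>Markov's inequality: one letter of depth \<open>N\<close> or more forces weight at least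
  \<open>e ^ N\<close>, while at most \<open>K * n + 1\<close> gaps enter the normalization. The
  constant \<open>c\<close> is the reciprocal of the resulting threshold.\<close>

lemma prob_deep:
  assumes len: "\<And>W. W \<in> set_pmf (ann_word H q PI PH n) \<Longrightarrow> length W \<le> K * n"
  shows "measure_pmf.prob (ann_word H q PI PH n) {W. \<not> (\<forall>(a, d)\<in>set W. d < N)}
           \<le> (real (K * n) + 1) powr e / e ^ N"
proof -
  let ?p = "ann_word H q PI PH n" and ?A = "{W. \<not> (\<forall>(a, d)\<in>set W. d < N)}"
  define c where "c = (real (K * n) + 1) powr e / e ^ N"
  have "indicator ?A W \<le> ennreal c * ennreal (normalized_weight W)" if "W \<in> set_pmf ?p" for W
  proof (cases "W \<in> ?A")
    case True
    then obtain a d where ad: "(a, d) \<in> set W" "N \<le> d" by auto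
    have "e ^ N \<le> e ^ d" using ad(2) by (intro power_increasing) auto
    also have "\<dots> \<le> depth_weight W" by (rule power_depth_le_weight[OF ad(1)])
    finally have w: "e ^ N \<le> depth_weight W" .
    have "(real (length W) + 1) powr e \<le> (real (K * n) + 1) powr e"
      using len[OF that] by (intro powr_mono2) (auto simp flip: of_nat_mult)
    with w have "e ^ N * (real (length W) + 1) powr e \<le> depth_weight W * (real (K * n) + 1) powr e"
      by (intro mult_mono) (auto intro: order_trans[OF _ w])
    then have "1 \<le> c * normalized_weight W"
      by (simp add: c_def normalized_weight_def field_simps)
    then show ?thesis
      using True normalized_weight_nonneg[of W] by (simp add: c_def flip: ennreal_mult)
  qed simp
  then have "(\<integral>\<^sup>+W. indicator ?A W \<partial>?p) \<le> (\<integral>\<^sup>+W. ennreal c * ennreal (normalized_weight W) \<partial>?p)"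
    by (intro nn_integral_mono_AE) (simp add: AE_measure_pmf_iff)
  also have "\<dots> = ennreal c * (\<integral>\<^sup>+W. ennreal (normalized_weight W) \<partial>?p)"
    by (rule nn_integral_cmult) simp
  also have "\<dots> \<le> ennreal c * 1"
    by (intro mult_left_mono nn_integral_ann_word) simp
  finally have "emeasure ?p ?A \<le> ennreal c" by simp
  then show ?thesis
    by (simp add: measure_pmf.emeasure_eq_measure c_def)
qed

section \<open>Asymptotics\<close>

text \<open>\<open>\<beta>\<close> to the power \<open>c * ln n\<close> is
  \<open>n powr (c * ln \<beta>)\<close>, hence at most \<open>n powr \<gamma>\<close>. The factor
  \<open>A * n + B\<close> supplies the further 1 in the exponent, and the rest is
  logarithmic.\<close>

lemma running_time_soft_O:
  fixes A B l \<beta> c \<gamma> C :: real and k :: nat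
  assumes nonneg: "0 \<le> A" "0 \<le> B" "0 \<le> l" "0 \<le> C" and "1 \<le> \<beta>" "0 < c" "0 \<le> \<gamma>" "c * ln \<beta> \<le> \<gamma>"
  defines "N \<equiv> \<lambda>n. nat \<lceil>c * ln (real n)\<rceil> + 1"
  shows "(\<lambda>n. (2 * real (N n) + 1) *
           (quasilinear C k ((A * real n + B) * (real (N n) * l + 1) * \<beta> ^ N n) + 1)) \<in> soft_O (1 + \<gamma>)"
proof -
  \<comment> \<open>With \<open>x = n\<close> and \<open>y = ln n\<close>, \<open>D\<close> bounds
    the size relative to \<open>y * x powr (1 + \<gamma>)\<close>, \<open>E\<close> bounds its
    shifted logarithm relative to \<open>y\<close>, and \<open>F\<close> is the final constant. The
    factor \<open>\<beta> powr 2\<close> pays for rounding up and adding 1 in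
    \<open>N\<close>.\<close>
  define D where "D = (A + B) * ((c + 2) * l + 1) * \<beta> powr 2"
  define E where "E = ln (D + 3) + 2 + \<gamma>"
  define F where "F = (2 * (c + 2) + 1) * (C * (D + 1) * E ^ k + 1)"
  have D: "0 \<le> D" using assms by (simp add: D_def)
  have E: "0 \<le> E" using D assms ln_add_3_ge_1[of D] by (simp add: E_def)
  have bound: "norm ((2 * real (N n) + 1) *
        (quasilinear C k ((A * real n + B) * (real (N n) * l + 1) * \<beta> ^ N n) + 1))
      \<le> F * norm (real n powr (1 + \<gamma>) * ln (real n) ^ (k + 2))" if "3 \<le> n" for n
  proof -
    define x where "x = real n"
    define y where "y = ln x"
    define S where "S = (A * x + B) * (real (N n) * l + 1) * \<beta> ^ N n"
    have x: "3 \<le> x" using that by (simp add: x_def)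
    have y: "1 \<le> y" using ln_add_3_ge_1[of "x - 3"] x by (simp add: y_def)
    have yx: "y \<le> x" unfolding y_def using ln_le_minus_one[of x] x by simp
    have N: "real (N n) \<le> c * y + 2"
      using y \<open>0 < c\<close> unfolding N_def y_def x_def by (simp add: ceiling_correct) linarith
    have N2: "real (N n) \<le> (c + 2) * y" using N y by (simp add: algebra_simps)
    have x1: "1 \<le> x powr (1 + \<gamma>)" using x \<open>0 \<le> \<gamma>\<close> by (intro ge_one_powr_ge_zero) auto
    have "\<beta> ^ N n = \<beta> powr real (N n)" using \<open>1 \<le> \<beta>\<close> by (simp add: powr_realpow)
    also have "\<dots> \<le> \<beta> powr (c * y + 2)" using N \<open>1 \<le> \<beta>\<close> by (intro powr_mono) auto
    also have "\<dots> = \<beta> powr 2 * exp (c * ln \<beta> * y)" using \<open>1 \<le> \<beta>\<close> by (simp add: powr_add) (simp add: powr_def algebra_simps)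
    also have "exp (c * ln \<beta> * y) \<le> exp (\<gamma> * y)" using \<open>c * ln \<beta> \<le> \<gamma>\<close> y by simp
    also have "exp (\<gamma> * y) = x powr \<gamma>" using x by (simp add: powr_def y_def)
    finally have b: "\<beta> ^ N n \<le> \<beta> powr 2 * x powr \<gamma>" using \<open>1 \<le> \<beta>\<close> by simp
    have "S \<le> ((A + B) * x) * (((c + 2) * l + 1) * y) * (\<beta> powr 2 * x powr \<gamma>)"
      unfolding S_def
    proof (intro mult_mono b)
      show "A * x + B \<le> (A + B) * x" using x \<open>0 \<le> B\<close> mult_left_mono[of 1 x B] by (simp add: algebra_simps)
      show "real (N n) * l + 1 \<le> ((c + 2) * l + 1) * y"
        using mult_right_mono[OF N2 \<open>0 \<le> l\<close>] y by (simp add: algebra_simps)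
    qed (use assms x y in auto)
    also have "\<dots> = D * (y * x powr (1 + \<gamma>))" using x by (simp add: D_def powr_add)
    finally have S: "S \<le> D * (y * x powr (1 + \<gamma>))" .
    have S0: "0 \<le> S" unfolding S_def using assms x by simp
    have yx1: "1 \<le> y * x powr (1 + \<gamma>)" using mult_mono[OF y x1] y by simp
    have S1: "S + 1 \<le> (D + 1) * (y * x powr (1 + \<gamma>))" using S yx1 by (simp add: algebra_simps)
    have "S + 3 \<le> (D + 3) * (y * x powr (1 + \<gamma>))" using S yx1 by (simp add: algebra_simps)
    also have "\<dots> \<le> (D + 3) * (x * x powr (1 + \<gamma>))"
      using D yx by (intro mult_left_mono mult_right_mono) auto
    also have "\<dots> = (D + 3) * x powr (2 + \<gamma>)" using x by (simp add: powr_add power2_eq_square powr_numeral)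
    finally have "ln (S + 3) \<le> ln ((D + 3) * x powr (2 + \<gamma>))"
      using S0 by (intro ln_mono) auto
    also have "\<dots> = ln (D + 3) + (2 + \<gamma>) * y"
      using D x by (simp add: ln_mult ln_powr y_def)
    also have "\<dots> \<le> E * y"
      using mult_left_mono[OF y, of "ln (D + 3)"] ln_add_3_ge_1[OF D] by (simp add: E_def algebra_simps)
    finally have lnS: "ln (S + 3) \<le> E * y" .
    have "quasilinear C k S \<le> C * ((D + 1) * (y * x powr (1 + \<gamma>))) * (E * y) ^ k"
      unfolding quasilinear_def using S1 lnS ln_add_3_ge_1[OF S0] S0 \<open>0 \<le> C\<close> D yx1 y
      by (intro mult_mono power_mono mult_nonneg_nonneg) auto
    also have "\<dots> = C * (D + 1) * E ^ k * (x powr (1 + \<gamma>) * y ^ Suc k)"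
      by (simp add: power_mult_distrib)
    finally have "quasilinear C k S + 1 \<le> (C * (D + 1) * E ^ k + 1) * (x powr (1 + \<gamma>) * y ^ Suc k)"
      using mult_mono[OF x1 one_le_power[OF y, of "Suc k"]] by (simp add: algebra_simps)
    moreover have "2 * real (N n) + 1 \<le> (2 * (c + 2) + 1) * y" using N2 y by (simp add: algebra_simps)
    moreover have "0 \<le> quasilinear C k S"
      unfolding quasilinear_def using ln_add_3_ge_1[OF S0] S0 \<open>0 \<le> C\<close> by simp
    ultimately have "(2 * real (N n) + 1) * (quasilinear C k S + 1)
        \<le> ((2 * (c + 2) + 1) * y) * ((C * (D + 1) * E ^ k + 1) * (x powr (1 + \<gamma>) * y ^ Suc k))"
      using y \<open>0 < c\<close> by (intro mult_mono) auto
    also have "\<dots> = F * (x powr (1 + \<gamma>) * y ^ (k + 2))" by (simp add: F_def)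
    finally have "(2 * real (N n) + 1) * (quasilinear C k S + 1) \<le> F * (x powr (1 + \<gamma>) * y ^ (k + 2))" .
    moreover have "0 \<le> (2 * real (N n) + 1) * (quasilinear C k S + 1)"
      using \<open>0 \<le> quasilinear C k S\<close> by simp
    ultimately show ?thesis using y by (simp add: S_def x_def y_def abs_mult)
  qed
  \<comment> \<open>Of the \<open>k + 2\<close> logarithms, \<open>k\<close> come from the nearly
    linear bound, one from \<open>N n\<close> inside the size and one from the number of
    iterations.\<close>
  show ?thesis
    unfolding soft_O_def
    by (rule UN_I[of "k + 2", OF UNIV_I], rule bigoI[of _ F], rule eventually_mono[OF eventually_ge_at_top[of 3] bound])
qed

text \<open>This is what makes \<open>2 / 5 * e\<^sup>2\<close> exceed \<open>e\<close>. The Taylor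
  bound 13/8 for \<open>exp (1 / 2)\<close> squares to 169/64, which is more than 5/2.\<close>

lemma e_gt: "5 / 2 < e"
proof -
  have "1 + 1 / 2 + (1 / 2)\<^sup>2 / 2 \<le> exp (1 / 2 :: real)" by (rule exp_lower_Taylor_quadratic) simp
  then have "(13 / 8) ^ 2 \<le> (exp (1 / 2 :: real)) ^ 2" by (intro power_mono) (auto simp: power2_eq_square)
  also have "(exp (1 / 2 :: real)) ^ 2 = e" by (simp flip: exp_of_nat_mult)
  finally show ?thesis by (simp add: power2_eq_square)
qed

text \<open>The exponent exceeds \<open>c * ln n\<close>, so the denominator is at least
  \<open>n powr c\<close>, against a numerator of order \<open>n powr e\<close>.\<close>

lemma deep_tendsto_0:
  fixes c K :: real
  assumes "e < c" "0 \<le> K"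
  shows "(\<lambda>n. (K * real n + 1) powr e / e ^ (nat \<lceil>c * ln (real n)\<rceil> + 1)) \<longlonglongrightarrow> 0"
proof (rule tendsto_sandwich)
  show "(\<lambda>n. 0) \<longlonglongrightarrow> (0 :: real)" by simp
  have "(\<lambda>n. real n powr (e - c)) \<longlonglongrightarrow> 0"
    using assms(1) by (intro tendsto_neg_powr filterlim_real_sequentially) simp
  from tendsto_mult_left[OF this, of "(K + 1) powr e"]
  show "(\<lambda>n. (K + 1) powr e * real n powr (e - c)) \<longlonglongrightarrow> 0" by simp
  show "\<forall>\<^sub>F n in sequentially. 0 \<le> (K * real n + 1) powr e / e ^ (nat \<lceil>c * ln (real n)\<rceil> + 1)" by simp
  show "\<forall>\<^sub>F n in sequentially. (K * real n + 1) powr e / e ^ (nat \<lceil>c * ln (real n)\<rceil> + 1)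
          \<le> (K + 1) powr e * real n powr (e - c)"
  proof (rule eventually_mono[OF eventually_ge_at_top[of 1]])
    fix n :: nat assume n: "1 \<le> n"
    let ?N = "nat \<lceil>c * ln (real n)\<rceil> + 1"
    have "real n powr c = exp (c * ln (real n))" using n by (simp add: powr_def)
    also have "\<dots> \<le> exp (real ?N)" by (simp, linarith)
    also have "\<dots> = e ^ ?N" using exp_of_nat_mult[of ?N "1 :: real"] by (simp only: mult_1_right)
    finally have pow: "real n powr c \<le> e ^ ?N" .
    have "(K * real n + 1) powr e \<le> ((K + 1) * real n) powr e"
      using n assms(2) by (intro powr_mono2) (auto simp: algebra_simps)
    also have "\<dots> = (K + 1) powr e * real n powr e" using assms(2) by (simp add: powr_mult)
    finally have "(K * real n + 1) powr e / e ^ ?N \<le> (K + 1) powr e * real n powr e / real n powr c"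
      using pow n by (intro frac_le) auto
    also have "\<dots> = (K + 1) powr e * real n powr (e - c)" using n by (simp add: powr_diff)
    finally show "(K * real n + 1) powr e / e ^ ?N \<le> (K + 1) powr e * real n powr (e - c)" .
  qed
qed

section \<open>Combination of the depth and time estimates\<close>

lemma length_freduce: "length (freduce w) \<le> length w"
proof (induction w)
  case (Cons a w)
  have "length (cancel_cons a v) \<le> Suc (length v)" for v by (cases v) auto
  with Cons show ?case by (auto simp: freduce_def intro: order_trans)
qed (simp add: freduce_def)

theorem theoremE:
  fixes X :: "'a set" and R H :: "'a gword set" and q :: real
    and PI PH :: "'a gword pmf"
    and write_time fold_time :: "'a xgraph \<Rightarrow> nat"
  assumes "finite X"
    and "finite R" and "R \<subseteq> carrier (free_group X)"
    and "finite H" and "H \<subseteq> carrier (free_group X)"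
    and "0 < q" and "q < 1"
    and "set_pmf PI \<subseteq> elem_identities X R"
    and "H \<noteq> {} \<Longrightarrow> set_pmf PH \<subseteq> H \<union> winv ` H"
    and "nearly_linear write_time" and "nearly_linear fold_time"
  shows "\<exists>T \<in> soft_O (1 + (exp 1)\<^sup>2 * ln (real (total_length R))).
           (\<lambda>n. measure_pmf.prob (RandomSubgroupWord2 H q PI PH n)
                  {w \<in> MSP X R H. ereal_of_enat (amp_time write_time fold_time R H w) \<le> ereal (T n)})
             \<longlonglongrightarrow> 1"
proof -
  let ?I = "elem_identities X R" and ?J = "H \<union> winv ` H" and ?L = "total_length R"
  define \<gamma> where "\<gamma> = (exp 1)\<^sup>2 * ln (real ?L)"
  \<comment> \<open>The factor 2/5 cancels the 5/2 of \<open>ln_growth_le\<close> and leaves the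
    exponent \<open>\<gamma>\<close>, while \<open>e_gt\<close> keeps \<open>c\<close> above
    \<open>e\<close>.\<close>
  define c where "c = 2 / 5 * e\<^sup>2"
  define N where "N = (\<lambda>n. nat \<lceil>c * ln (real n)\<rceil> + 1)"
  have c: "e < c" using e_gt mult_strict_right_mono[OF e_gt, of e] by (simp add: c_def power2_eq_square)
  have "0 < c" by (simp add: c_def)
  have \<gamma>: "0 \<le> \<gamma>" "c * ln (real (growth R)) \<le> \<gamma>"
  proof -
    show "0 \<le> \<gamma>" by (cases "?L = 0") (auto simp: \<gamma>_def)
    show "c * ln (real (growth R)) \<le> \<gamma>"
    proof (cases "?L = 0")
      case True
      then show ?thesis using growth_trivial[OF assms(2)] by (simp add: \<gamma>_def)
    next
      case False
      then have "c * ln (real (growth R)) \<le> c * (5 / 2 * ln (real ?L))"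
        using ln_growth_le[OF assms(2)] \<open>0 < c\<close> by (intro mult_left_mono) auto
      then show ?thesis by (simp add: \<gamma>_def c_def)
    qed
  qed
  obtain K where K: "\<And>u. u \<in> ?I \<union> ?J \<Longrightarrow> length u \<le> K"
  proof -
    have fin: "finite (length ` (R \<union> ?J))" using assms(2,4) by simp
    \<comment> \<open>The 2 covers the words \<open>[a, linv a]\<close>; the inserted 0 keeps
      \<open>Max\<close> meaningful when there are no other words.\<close>
    have "length u \<le> 2 + Max (insert 0 (length ` (R \<union> ?J)))" if "u \<in> ?I \<union> ?J" for u
    proof (cases "u \<in> R \<union> ?J")
      case True
      then have "length u \<le> Max (insert 0 (length ` (R \<union> ?J)))" using fin by (intro Max_ge) auto
      then show ?thesis by simp
    next
      case False
      then show ?thesis using that by (auto simp: elem_identities_def)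
    qed
    with that show ?thesis by blast
  qed
  obtain C k where C: "0 \<le> C" and time: "\<And>w N S. amp_stops R H w N \<Longrightarrow>
       real (size_graph (initial_graph H w)) * (real N * real (total_length (star R)) + 1) * real (growth R) ^ N \<le> S \<Longrightarrow>
       ereal_of_enat (amp_time write_time fold_time R H w) \<le> ereal ((2 * real N + 1) * (quasilinear C k S + 1))"
    using amp_time_bound[OF assms(2,4,10,11)] by blast
  define B where "B = 1 + (\<Sum>h\<in>H. 2 * length h + 1)"
  define S where "S = (\<lambda>n. (2 * real K * real n + real B) *
      (real (N n) * real (total_length (star R)) + 1) * real (growth R) ^ N n)"
  define T where "T = (\<lambda>n. (2 * real (N n) + 1) * (quasilinear C k (S n) + 1))"
  have T: "T \<in> soft_O (1 + (exp 1)\<^sup>2 * ln (real ?L))"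
    unfolding T_def S_def N_def \<gamma>_def[symmetric]
    using C \<gamma> \<open>0 < c\<close> growth_ge_1[of R] by (intro running_time_soft_O) auto

  let ?p = "ann_word H q PI PH" and ?w = "\<lambda>W. freduce (map fst W)"
  let ?deep = "\<lambda>n. {W. \<not> (\<forall>(a, d)\<in>set W. d < N n)}"
  let ?A = "\<lambda>n. {w \<in> MSP X R H. ereal_of_enat (amp_time write_time fold_time R H w) \<le> ereal (T n)}"
  have reach: "ann_reach ?I ?J W" "length W \<le> K * n" if "W \<in> set_pmf (?p n)" for W n
    using ann_word_reach[OF assms(8,9) K that] by auto
  \<comment> \<open>Within the support the depth condition alone suffices: the length bound and
    membership in the subgroup hold surely.\<close>
  have fast: "?w W \<in> ?A n" if W: "W \<in> set_pmf (?p n)" "W \<notin> ?deep n" for W n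
  proof -
    have "size_graph (initial_graph H (?w W)) \<le> 2 * length (?w W) + B"
      using size_initial[OF assms(4), of "?w W"] by (simp add: B_def)
    also have "\<dots> \<le> 2 * (K * n) + B"
      using length_freduce[of "map fst W"] reach(2)[OF W(1)] by simp
    finally have "real (size_graph (initial_graph H (?w W))) \<le> real (2 * (K * n) + B)"
      by (simp only: of_nat_le_iff)
    also have "\<dots> = 2 * real K * real n + real B" by simp
    finally have "real (size_graph (initial_graph H (?w W))) \<le> 2 * real K * real n + real B" .
    then have "real (size_graph (initial_graph H (?w W))) * (real (N n) * real (total_length (star R)) + 1)
        * real (growth R) ^ N n \<le> S n"
      unfolding S_def by (intro mult_right_mono) auto
    moreover have "amp_stops R H (?w W) (N n)"
      using W(2) by (intro amp_stops_if_depths_less[OF reach(1)[OF W(1)]]) (auto simp: N_def)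
    ultimately show ?thesis
      using time reach_in_MSP[OF assms(3,5) reach(1)[OF W(1)]] by (simp add: T_def)
  qed
  have lower: "1 - (real K * real n + 1) powr e / e ^ N n \<le> measure_pmf.prob (RandomSubgroupWord2 H q PI PH n) (?A n)" for n
  proof -
    have "RandomSubgroupWord2 H q PI PH n = map_pmf ?w (?p n)"
      by (simp add: RandomSubgroupWord2_def pmf.map_comp comp_def flip: map_ann_word)
    then have "measure_pmf.prob (RandomSubgroupWord2 H q PI PH n) (?A n) = measure_pmf.prob (?p n) (?w -` ?A n)"
      by simp
    \<comment> \<open>The inclusion of events is known only on the support, hence the
      almost-everywhere form of monotonicity.\<close>
    also have "\<dots> \<ge> measure_pmf.prob (?p n) (UNIV - ?deep n)"
      by (rule measure_pmf.finite_measure_mono_AE) (use fast in \<open>auto simp: AE_measure_pmf_iff\<close>)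
    also have "measure_pmf.prob (?p n) (UNIV - ?deep n) = 1 - measure_pmf.prob (?p n) (?deep n)"
      using measure_pmf.prob_compl[of "?deep n" "?p n"] by simp
    finally show ?thesis using prob_deep[of H q PI PH n K "N n"] reach(2) by simp
  qed
  have "(\<lambda>n. measure_pmf.prob (RandomSubgroupWord2 H q PI PH n) (?A n)) \<longlonglongrightarrow> 1"
  proof (rule tendsto_sandwich)
    have "(\<lambda>n. 1 - (real K * real n + 1) powr e / e ^ N n) \<longlonglongrightarrow> 1 - 0"
      unfolding N_def by (intro tendsto_diff tendsto_const deep_tendsto_0[OF c]) simp
    then show "(\<lambda>n. 1 - (real K * real n + 1) powr e / e ^ N n) \<longlonglongrightarrow> 1" by simp
    show "(\<lambda>n. 1) \<longlonglongrightarrow> (1 :: real)" by simp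
    show "\<forall>\<^sub>F n in sequentially. 1 - (real K * real n + 1) powr e / e ^ N n
            \<le> measure_pmf.prob (RandomSubgroupWord2 H q PI PH n) (?A n)" using lower by simp
    show "\<forall>\<^sub>F n in sequentially. measure_pmf.prob (RandomSubgroupWord2 H q PI PH n) (?A n) \<le> 1"
      by (intro always_eventually allI measure_pmf.prob_le_1)
  qed
  with T show ?thesis by blast
qed

end
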